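(* We have $$\sum_{n=0}^\infty\frac n{4^n}\sum_{k=0}^n\binom{-1/4}k^2\binom{-3/4}{n-k}^2=\frac{4\sqrt3}{9\pi},\qquad \sum_{n=0}^\infty\frac{9n+2}{(-8)^n}\sum_{k=0}^n\binom{-1/4}k^2\binom{-3/4}{n-k}^2=\frac 4{\pi},$$ $$\sum_{n=0}^\infty\frac{9n+1}{64^n}\sum_{k=0}^n\binom{-1/4}k^2\binom{-3/4}{n-k}^2=\frac {64}{7\sqrt7\,\pi}.$$
   Context: For real $a$ and a nonnegative integer $k$, $\binom{a}{k}=\frac{a(a-1)\cdots(a-k+1)}{k!}$ (with $\binom a0=1$). *)

theory Defs
  imports "HOL-Analysis.Analysis"
begin

end

theory Submission
  imports Defs
begin

text \<open>
  Let \<open>F(z) = 2F1(1/4, 3/4; 1; z)\<close>. By Pfaff's transformation the generating function of the inner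
  sums is \<open>F(x/(x-1))^2 / (1-x)\<close>, so each series is a combination of \<open>F^2\<close> and \<open>F F'\<close> at
  \<open>z = -1/3\<close>, \<open>1/9\<close> and \<open>-1/63\<close>.

  With \<open>w* = (1-w)/(1+3w)\<close>, the functions \<open>F(w^2)\<close> and \<open>(1+3w)^(-1/2) F(w*^2)\<close> solve the same
  self-adjoint equation \<open>(w (1-w^2) y')' = (3/4) w y\<close>. Hence their Wronskian is a constant multiple of
  \<open>1/(w (1-w^2))\<close>, and the limit at \<open>w = 0\<close> (an Abelian theorem and the reflection formula for
  \<open>\<Gamma>\<close>) gives the constant \<open>-1/(\<pi> \<surd>2)\<close>. At a point with complex multiplication, both solutions
  are algebraic multiples of values of \<open>F\<close> at one and the same point, and the Wronskian relation becomes
  the required evaluation. For \<open>1/9\<close> and \<open>-1/3\<close> one takes the points \<open>w = 1/3\<close>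
  (with \<open>w* = w\<close>) and \<open>w = i/\<surd>3\<close> (with \<open>w* = -w\<close>). For \<open>-1/63\<close> one takes
  \<open>w = (5 + i\<surd>7)/6\<close>, for which \<open>w*^2 = -1/63\<close>, and relates \<open>F(w^2)\<close> to \<open>F(-1/63)\<close> by the
  quadratic transformation \<open>F(1 - w*^2) = (1+3w)^(1/2) F(w^2)\<close> at \<open>w = i/(3\<surd>7)\<close>, where
  \<open>1 - w*^2 = ((5 + i\<surd>7)/6)^2\<close>. That transformation holds because both sides solve the equation above and are regular at the singular point 0.
\<close>

section \<open>Gaussian hypergeometric series with third parameter 1\<close>

definition hyp_fps :: "real \<Rightarrow> real \<Rightarrow> complex fps" where
  "hyp_fps a b = Abs_fps (\<lambda>n. of_real (pochhammer a n * pochhammer b n / fact n ^ 2))"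

definition hyp :: "real \<Rightarrow> real \<Rightarrow> complex \<Rightarrow> complex" where
  "hyp a b = eval_fps (hyp_fps a b)"

text \<open>The derivative is formed coefficientwise, so that differential equations can be checked
  on formal power series and then evaluated inside the unit disc.\<close>

definition hyp' :: "real \<Rightarrow> real \<Rightarrow> complex \<Rightarrow> complex" where
  "hyp' a b = eval_fps (fps_deriv (hyp_fps a b))"

text \<open>For 0 < c < 1 each factor c + i of the Pochhammer symbol is at most the factor i + 1 of
  n!. The crude bound 1 suffices both for the radius of convergence and for the nonvanishing near
  0.\<close>

lemma hyp_fps_nth_bound:
  assumes "0 < a" "a < 1" "0 < b" "b < 1"
  shows "norm (fps_nth (hyp_fps a b) n) \<le> 1"
proof -
  have *: "0 \<le> pochhammer c n \<and> pochhammer c n \<le> fact n" if "0 < c" "c < 1" for c :: real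
  proof (induction n)
    case (Suc n)
    have "pochhammer c n * (c + n) \<le> fact n * (1 + real n)"
      using Suc that by (intro mult_mono) auto
    thus ?case using Suc that by (simp add: pochhammer_Suc algebra_simps)
  qed auto
  have "pochhammer a n * pochhammer b n \<le> fact n * fact n"
    using *[of a] *[of b] assms by (intro mult_mono) auto
  hence "pochhammer a n * pochhammer b n / fact n ^ 2 \<le> 1"
    by (simp add: power2_eq_square)
  moreover have "pochhammer a n * pochhammer b n / fact n ^ 2 \<ge> 0"
    using *[of a] *[of b] assms by simp
  ultimately show ?thesis unfolding hyp_fps_def fps_nth_Abs_fps norm_of_real by linarith
qed

lemma fps_conv_radius_hyp:
  assumes "0 < a" "a < 1" "0 < b" "b < 1"
  shows "fps_conv_radius (hyp_fps a b) \<ge> 1"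
  unfolding fps_conv_radius_def
proof (rule conv_radius_geI_ex)
  fix r :: real assume r: "0 < r" "ereal r < 1"
  have "summable (\<lambda>n. fps_nth (hyp_fps a b) n * of_real r ^ n)"
  proof (rule summable_comparison_test)
    show "\<exists>N. \<forall>n\<ge>N. norm (fps_nth (hyp_fps a b) n * of_real r ^ n) \<le> r ^ n"
      using hyp_fps_nth_bound[OF assms] r
      by (auto simp: norm_mult norm_power intro!: exI[of _ 0] mult_left_le_one_le)
    show "summable (\<lambda>n. r ^ n)"
      using r by (intro summable_geometric) auto
  qed
  thus "\<exists>z. norm z = r \<and> summable (\<lambda>n. fps_nth (hyp_fps a b) n * z ^ n)"
    using r by (intro exI[of _ "of_real r"]) auto
qed

lemma hyp_at_0 [simp]: "hyp a b 0 = 1"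
  by (simp add: hyp_def hyp_fps_def eval_fps_at_0)

context
  fixes a b :: real
  assumes ab: "0 < a" "a < 1" "0 < b" "b < 1"
begin

lemma norm_less_hyp_conv_radius:
  assumes "norm z < 1"
  shows "ereal (norm z) < fps_conv_radius (hyp_fps a b)"
        "ereal (norm z) < fps_conv_radius (fps_deriv (hyp_fps a b))"
        "ereal (norm z) < fps_conv_radius (fps_deriv (fps_deriv (hyp_fps a b)))"
proof -
  have "ereal (norm z) < 1" using assms by simp
  also have 1: "1 \<le> fps_conv_radius (hyp_fps a b)" by (rule fps_conv_radius_hyp[OF ab])
  finally show *: "ereal (norm z) < fps_conv_radius (hyp_fps a b)" .
  also note fps_conv_radius_deriv
  finally show "ereal (norm z) < fps_conv_radius (fps_deriv (hyp_fps a b))" .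
  also note fps_conv_radius_deriv
  finally show "ereal (norm z) < fps_conv_radius (fps_deriv (fps_deriv (hyp_fps a b)))" .
qed

lemma has_field_derivative_hyp:
  assumes "norm z < 1"
  shows "(hyp a b has_field_derivative hyp' a b z) (at z)"
  unfolding hyp_def hyp'_def
  by (rule has_field_derivative_eval_fps norm_less_hyp_conv_radius assms)+

text \<open>Comparing coefficients turns the hypergeometric equation into the two-term recurrence
  \<open>rec\<close>, which is just the quotient of consecutive coefficients.\<close>

lemma hyp_fps_ode:
  "fps_X * (1 - fps_X) * fps_deriv (fps_deriv (hyp_fps a b))
     + (1 - fps_const (of_real (a + b + 1)) * fps_X) * fps_deriv (hyp_fps a b)
   = fps_const (of_real (a * b)) * hyp_fps a b"
proof (rule fps_ext)
  fix n
  have rec: "of_nat (Suc n) ^ 2 * fps_nth (hyp_fps a b) (Suc n) =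
        of_real ((a + n) * (b + n)) * fps_nth (hyp_fps a b) n"
  proof -
    have "real (Suc n) ^ 2 * (pochhammer a (Suc n) * pochhammer b (Suc n) / fact (Suc n) ^ 2) =
        (a + n) * (b + n) * (pochhammer a n * pochhammer b n / fact n ^ 2)"
      by (simp add: pochhammer_Suc power_mult_distrib field_simps del: of_nat_Suc)
    thus ?thesis unfolding hyp_fps_def fps_nth_Abs_fps
      by (metis of_real_mult of_real_of_nat_eq of_real_power)
  qed
  define E where "E = fps_nth (hyp_fps a b)"
  have 1: "fps_nth (fps_X * fps_deriv (fps_deriv (hyp_fps a b))) n = of_nat n * of_nat (Suc n) * E (Suc n)"
    by (cases n) (simp_all add: E_def)
  \<comment> \<open>Multiplication by X shifts indices; the factors n and n - 1 vanish exactly where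
    the shifted coefficient is missing, so one formula covers all n.\<close>
  have 2: "fps_nth (fps_X * (fps_X * fps_deriv (fps_deriv (hyp_fps a b)))) n = of_nat n * (of_nat n - 1) * E n"
    by (cases n; cases "n - 1") (simp_all add: E_def)
  have 3: "fps_nth (fps_X * fps_deriv (hyp_fps a b)) n = of_nat n * E n"
    by (cases n) (simp_all add: E_def)
  have 4: "fps_nth (fps_deriv (hyp_fps a b)) n = of_nat (Suc n) * E (Suc n)"
    by (simp add: E_def)
  have *: "fps_X * (1 - fps_X) * D + (1 - c * fps_X) * D' = fps_X * D - fps_X * (fps_X * D) + D' - c * (fps_X * D')"
    for c D D' :: "complex fps"
    by (simp add: algebra_simps)
  have "of_nat n * of_nat (Suc n) * E (Suc n) - of_nat n * (of_nat n - 1) * E n + of_nat (Suc n) * E (Suc n)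
          - of_real (a + b + 1) * (of_nat n * E n) = of_real (a * b) * E n"
    using rec by (simp add: E_def algebra_simps power2_eq_square)
  thus "fps_nth (fps_X * (1 - fps_X) * fps_deriv (fps_deriv (hyp_fps a b))
     + (1 - fps_const (of_real (a + b + 1)) * fps_X) * fps_deriv (hyp_fps a b)) n
     = fps_nth (fps_const (of_real (a * b)) * hyp_fps a b) n"
    unfolding * fps_add_nth fps_sub_nth fps_mult_left_const_nth 1 2 3 4
    by (simp only: E_def)
qed

lemma hyp'_ode:
  assumes "norm z < 1"
  obtains d where "(hyp' a b has_field_derivative d) (at z)"
    "z * (1 - z) * d + (1 - of_real (a + b + 1) * z) * hyp' a b z = of_real (a * b) * hyp a b z"
proof
  define d where "d = eval_fps (fps_deriv (fps_deriv (hyp_fps a b))) z"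
  note c = norm_less_hyp_conv_radius[OF assms]
  show "(hyp' a b has_field_derivative d) (at z)"
    unfolding hyp'_def d_def by (rule has_field_derivative_eval_fps c)+
  have 1: "fps_conv_radius (1 - c * fps_X :: complex fps) = \<infinity>" if "fps_conv_radius c = \<infinity>" for c
    using fps_conv_radius_diff[of 1 "c * fps_X"] fps_conv_radius_mult[of c fps_X] that
    by (auto simp: min_def)
  have 2: "fps_conv_radius (fps_X * (1 - fps_X) :: complex fps) = \<infinity>"
    using fps_conv_radius_mult[of fps_X "1 - fps_X :: complex fps"] 1[of 1] by simp
  have 3: "ereal (norm z) < fps_conv_radius (x * y)"
    if "fps_conv_radius x = \<infinity>" "ereal (norm z) < fps_conv_radius y" for x y :: "complex fps"
    using fps_conv_radius_mult[of x y] that by auto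
  have "eval_fps (fps_X * (1 - fps_X) * fps_deriv (fps_deriv (hyp_fps a b))
     + (1 - fps_const (of_real (a + b + 1)) * fps_X) * fps_deriv (hyp_fps a b)) z
      = eval_fps (fps_const (of_real (a * b)) * hyp_fps a b) z"
    by (simp only: hyp_fps_ode)
  thus "z * (1 - z) * d + (1 - of_real (a + b + 1) * z) * hyp' a b z = of_real (a * b) * hyp a b z"
    using 1[of "fps_const (of_real (a + b + 1))"] 1[of 1] c
    by (simp add: d_def hyp_def hyp'_def eval_fps_add eval_fps_mult eval_fps_diff 1 2 3 
          del: of_real_add of_real_mult)
qed

text \<open>The constant term 1 dominates: the remaining terms sum to at most |z| / (1 - |z|), which
  is below 1 for |z| < 1/2. The uniqueness argument below divides by a solution and relies on
  this.\<close>

lemma hyp_nonzero: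
  assumes "norm z < 1 / 2"
  shows "hyp a b z \<noteq> 0"
proof
  assume 0: "hyp a b z = 0"
  let ?c = "fps_nth (hyp_fps a b)"
  have z: "norm z < 1" using assms by simp
  have "(\<lambda>n. ?c n * z ^ n) sums hyp a b z"
    unfolding hyp_def by (rule sums_eval_fps norm_less_hyp_conv_radius z)+
  hence "(\<lambda>n. ?c (Suc n) * z ^ Suc n) sums (0 - 1)"
    using sums_Suc_iff[of "\<lambda>n. ?c n * z ^ n" "-1"] by (simp add: 0 hyp_fps_def)
  moreover have "(\<lambda>n. norm z * norm z ^ n) sums (norm z * (1 / (1 - norm z)))"
    using z by (intro sums_mult geometric_sums) auto
  moreover have "norm (?c (Suc n) * z ^ Suc n) \<le> norm z * norm z ^ n" for n
    using mult_right_mono[OF hyp_fps_nth_bound[OF ab, of "Suc n"], of "norm z ^ Suc n"]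
    by (simp add: norm_mult norm_power)
  ultimately have "norm (-1 :: complex) \<le> norm z * (1 / (1 - norm z))"
    by (metis (no_types, lifting) diff_0 norm_suminf_le sums_iff)
  thus False using assms by (simp add: field_simps)
qed

end

section \<open>Sturm--Liouville uniqueness and the Pfaff transformation\<close>

text \<open>By self-adjointness P (u v' - u' v) has derivative 0, and it vanishes at 0 because P
  does. Hence v / u is constant. So at a singular point the initial value alone determines a
  solution that is regular there.\<close>

lemma sturm_liouville_unique:
  fixes u v u' v' P Q :: "complex \<Rightarrow> complex"
  assumes S: "convex S" "0 \<in> S" and P: "P 0 = 0" "\<And>x. x \<in> S \<Longrightarrow> x \<noteq> 0 \<Longrightarrow> P x \<noteq> 0"
    and u: "\<And>x. x \<in> S \<Longrightarrow> (u has_field_derivative u' x) (at x within S)"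
    and v: "\<And>x. x \<in> S \<Longrightarrow> (v has_field_derivative v' x) (at x within S)"
    and u': "\<And>x. x \<in> S \<Longrightarrow> ((\<lambda>x. P x * u' x) has_field_derivative Q x * u x) (at x within S)"
    and v': "\<And>x. x \<in> S \<Longrightarrow> ((\<lambda>x. P x * v' x) has_field_derivative Q x * v x) (at x within S)"
    and init: "v 0 = u 0" and nz: "\<And>x. x \<in> S \<Longrightarrow> u x \<noteq> 0"
    and z: "z \<in> S"
  shows "v z = u z" and "z \<noteq> 0 \<Longrightarrow> v' z = u' z"
proof -
  define W where "W x = u x * (P x * v' x) - (P x * u' x) * v x" for x
  have "(W has_field_derivative 0) (at x within S)" if "x \<in> S" for x
    unfolding W_def
    by (rule DERIV_cong, (rule derivative_intros u v u' v' that)+) (simp add: algebra_simps)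
  then obtain c where "\<And>x. x \<in> S \<Longrightarrow> W x = c"
    using has_field_derivative_zero_constant[OF S(1)] by blast
  moreover have "W 0 = 0" by (simp add: W_def P)
  ultimately have W: "W x = 0" if "x \<in> S" for x
    using S that by metis
  have W': "u x * v' x - u' x * v x = 0" if "x \<in> S" "x \<noteq> 0" for x
  proof -
    have "P x * (u x * v' x - u' x * v x) = 0"
      using W[OF that(1)] by (simp add: W_def algebra_simps)
    thus ?thesis using P(2)[OF that] by simp
  qed
  have eq: "v x = u x" if "x \<in> S" for x
  proof -
    \<comment> \<open>Since P 0 = 0, the relation \<open>W'\<close> says nothing at 0. Continuity of
      the quotient there, with 0 as an exceptional point, bridges the gap.\<close>
    have "v x / u x = 1"
    proof (rule has_derivative_zero_unique_strong_convex[OF S(1) _ _ S(2), where f = "\<lambda>x. v x / u x" and K = "{0}"])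
      show "continuous_on S (\<lambda>x. v x / u x)"
        using DERIV_continuous_on[OF u] DERIV_continuous_on[OF v] nz by (intro continuous_on_divide) auto
      show "v 0 / u 0 = 1" using nz[OF S(2)] init by simp
      fix x assume "x \<in> S - {0}"
      hence x: "x \<in> S" "x \<noteq> 0" by auto
      have "((\<lambda>x. v x / u x) has_field_derivative 0) (at x within S)"
        by (rule DERIV_cong[OF DERIV_divide[OF v[OF x(1)] u[OF x(1)] nz[OF x(1)]]])
           (use W'[OF x] in \<open>simp add: algebra_simps\<close>)
      thus "((\<lambda>x. v x / u x) has_derivative (\<lambda>h. 0)) (at x within S)"
        by (simp add: has_field_derivative_def lambda_zero)
    qed (use that in auto)
    thus ?thesis using nz[OF that] by simp
  qed
  show "v z = u z" by (rule eq z)+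
  assume "z \<noteq> 0"
  hence "u z * v' z - u' z * u z = 0" using W'[OF z] eq[OF z] by simp
  hence "u z * (v' z - u' z) = 0" by (simp add: algebra_simps)
  thus "v' z = u' z" using nz[OF z] by simp
qed

text \<open>For b = 1 - a the coefficient of the first derivative is 1 - 2 z, the derivative of z (1
  - z), so the equation is self-adjoint as it stands.\<close>

lemma hyp_self_adjoint:
  assumes "0 < a" "a < 1" "norm z < 1"
  shows "((\<lambda>z. z * (1 - z) * hyp' a (1 - a) z) has_field_derivative
           of_real (a * (1 - a)) * hyp a (1 - a) z) (at z)"
proof -
  obtain d where [derivative_intros]: "(hyp' a (1 - a) has_field_derivative d) (at z)"
    and d: "z * (1 - z) * d + (1 - of_real (a + (1 - a) + 1) * z) * hyp' a (1 - a) z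
      = of_real (a * (1 - a)) * hyp a (1 - a) z"
    using hyp'_ode[of a "1 - a" z] assms by auto
  show ?thesis unfolding d[symmetric]
    by (auto intro!: derivative_eq_intros simp: algebra_simps)
qed

text \<open>For b = a the integrating factor (1 - z)^(2a - 1) is needed; the principal branch is
  holomorphic here because Re z < 1.\<close>

lemma hyp_self_adjoint_same:
  assumes "0 < a" "a < 1" "norm z < 1"
  shows "((\<lambda>z. z * (1 - z) powr (2 * of_real a) * hyp' a a z) has_field_derivative
           of_real (a ^ 2) * (1 - z) powr (2 * of_real a - 1) * hyp a a z) (at z)"
proof -
  obtain d where d': "(hyp' a a has_field_derivative d) (at z)"
    and d: "z * (1 - z) * d + (1 - of_real (a + a + 1) * z) * hyp' a a z = of_real (a * a) * hyp a a z"
    using hyp'_ode[of a a z] assms by auto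
  have "Re z < 1" using complex_Re_le_cmod[of z] assms by simp
  hence z: "1 - z \<notin> \<real>\<^sub>\<le>\<^sub>0" "1 - z \<noteq> 0" by (auto simp: complex_nonpos_Reals_iff)
  define u where "u = (1 - z) powr (2 * of_real a - 1)"
  have u: "(1 - z) powr (2 * of_real a) = (1 - z) * u"
    using z by (simp add: u_def powr_diff)
  have 1: "((\<lambda>z. (1 - z) powr (2 * of_real a)) has_field_derivative - 2 * of_real a * u) (at z)"
    unfolding u_def by (rule DERIV_cong, (rule derivative_eq_intros refl z | simp)+)
  have 2: "((\<lambda>z. z * (1 - z) powr (2 * of_real a)) has_field_derivative (1 - z) * u - 2 * of_real a * z * u) (at z)"
    by (rule DERIV_cong[OF DERIV_mult[OF DERIV_ident 1]]) (unfold u, simp)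
  have "((1 - z) * u - 2 * of_real a * z * u) * hyp' a a z + d * (z * (1 - z) powr (2 * of_real a)) =
    u * (z * (1 - z) * d + (1 - of_real (a + a + 1) * z) * hyp' a a z)"
    unfolding u by (simp add: algebra_simps)
  also have "\<dots> = of_real (a ^ 2) * u * hyp a a z"
    unfolding d by (simp add: power2_eq_square)
  finally show ?thesis
    using DERIV_mult[OF 2 d'] by (simp only: u_def)
qed

text \<open>The right-hand side satisfies the self-adjoint equation of \<open>hyp a a\<close> and
  has the same value 1 at 0, so \<open>sturm_liouville_unique\<close> applies. The radius 1/2 keeps
  x / (x - 1) in the unit disc and \<open>hyp a a\<close> away from zero.\<close>

lemma hyp_Pfaff:
  assumes a: "0 < a" "a < 1" and x: "norm x < 1 / 2"
  shows "hyp a a x = (1 - x) powr (- of_real a) * hyp a (1 - a) (x / (x - 1))"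
proof -
  define S :: "complex set" where "S = ball 0 (1 / 2)"
  have S: "1 - x \<notin> \<real>\<^sub>\<le>\<^sub>0" "1 - x \<noteq> 0" "x - 1 \<noteq> 0" "norm (x / (x - 1)) < 1" "norm x < 1" if "x \<in> S" for x
  proof -
    have *: "norm x < 1 / 2" using that by (simp add: S_def)
    have "Re x < 1" using complex_Re_le_cmod[of x] * by simp
    thus 1: "1 - x \<notin> \<real>\<^sub>\<le>\<^sub>0" "1 - x \<noteq> 0" "x - 1 \<noteq> 0" by (auto simp: complex_nonpos_Reals_iff)
    have "norm x < norm (x - 1)" using norm_triangle_ineq4[of x "x - 1"] * by simp
    thus "norm (x / (x - 1)) < 1" using 1 by (simp add: norm_divide)
    show "norm x < 1" using * by simp
  qed
  define F where "F = hyp a (1 - a)"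
  define F' where "F' = hyp' a (1 - a)"
  define p where "p z = z * (1 - z) * F' z" for z
  have F [derivative_intros]: "(F has_field_derivative F' z) (at z)" if "norm z < 1" for z
    unfolding F_def F'_def using a that by (intro has_field_derivative_hyp) auto
  have p [derivative_intros]: "(p has_field_derivative of_real (a * (1 - a)) * F z) (at z)" if "norm z < 1" for z
    unfolding p_def F_def F'_def using a that by (intro hyp_self_adjoint) auto
  let ?z = "\<lambda>x. x / (x - 1)"
  have z: "(?z has_field_derivative (- 1 / (1 - x) ^ 2)) (at x)" if "x \<in> S" for x
    using S[OF that]
    by (auto intro!: derivative_eq_intros simp: divide_simps power2_eq_square; simp add: algebra_simps)
  have Fz: "((\<lambda>x. F (?z x)) has_field_derivative F' (?z x) * (- 1 / (1 - x) ^ 2)) (at x)" if "x \<in> S" for x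
    using DERIV_chain2[OF F z, of x] S that by auto
  have pz: "((\<lambda>x. p (?z x)) has_field_derivative of_real (a * (1 - a)) * F (?z x) * (- 1 / (1 - x) ^ 2)) (at x)" if "x \<in> S" for x
    using DERIV_chain2[OF p z, of x] S that by auto
  define y where "y x = (1 - x) powr (- of_real a) * F (?z x)" for x
  define y' where "y' x = of_real a * (1 - x) powr (- of_real a - 1) * F (?z x)
     - (1 - x) powr (- of_real a - 2) * F' (?z x)" for x
  have y: "(y has_field_derivative y' x) (at x)" if "x \<in> S" for x
  proof -
    have "(1 - x) powr (- of_real a - 2) = (1 - x) powr (- of_real a) / (1 - x) ^ 2"
      using S[OF that] by (simp add: powr_diff)
    thus ?thesis unfolding y_def y'_def
      by (intro DERIV_cong[OF DERIV_mult[OF _ Fz]]) (use S[OF that] that in \<open>auto intro!: derivative_eq_intros\<close>)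
  qed
  \<comment> \<open>Written through \<open>p\<close>, whose derivative is known from the
    self-adjoint equation, this expression can be differentiated without a second derivative of
    F.\<close>
  have Py': "x * (1 - x) powr (2 * of_real a) * y' x =
     of_real a * x * (1 - x) powr (of_real a - 1) * F (?z x) + (1 - x) powr of_real a * p (?z x)"
    if "x \<in> S" for x
  proof -
    define u where "u = (1 - x) powr of_real a"
    have pw: "(1 - x) powr (2 * of_real a) = u * u" "(1 - x) powr (of_real a - 1) = u / (1 - x)"
      "(1 - x) powr (- of_real a - 2) = 1 / (u * (1 - x) ^ 2)" "(1 - x) powr (- of_real a - 1) = 1 / (u * (1 - x))"
      and u: "u \<noteq> 0"
      using S[OF that] by (simp_all add: u_def powr_diff powr_minus_divide flip: powr_add)
    have z: "?z x * (1 - ?z x) = - x / (1 - x) ^ 2" "1 - x \<noteq> 0"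
      using S[OF that] by (simp_all add: divide_simps power2_eq_square) (simp_all add: algebra_simps)
    show ?thesis unfolding y'_def p_def pw u_def[symmetric] z(1) using u z(2)
      by (simp add: divide_simps power2_eq_square) (simp add: algebra_simps)
  qed
  have "y x = hyp a a x"
  proof (rule sturm_liouville_unique(1)[where S = S and u = "hyp a a" and v = y and P = "\<lambda>x. x * (1 - x) powr (2 * of_real a)" and u' = "hyp' a a" and v' = y'
         and Q = "\<lambda>x. of_real (a ^ 2) * (1 - x) powr (2 * of_real a - 1)"])
    fix x assume x: "x \<in> S"
    show "(hyp a a has_field_derivative hyp' a a x) (at x within S)"
      by (rule has_field_derivative_at_within, rule has_field_derivative_hyp) (use a S[OF x] in auto)
    show "(y has_field_derivative y' x) (at x within S)"
      by (rule has_field_derivative_at_within, rule y) (rule x)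
    show "((\<lambda>x. x * (1 - x) powr (2 * of_real a) * hyp' a a x) has_field_derivative of_real (a ^ 2) * (1 - x) powr (2 * of_real a - 1) * hyp a a x) (at x within S)"
      by (rule has_field_derivative_at_within, rule hyp_self_adjoint_same) (use a S[OF x] in auto)
    show "hyp a a x \<noteq> 0"
      by (rule hyp_nonzero) (use a x in \<open>auto simp: S_def\<close>)
    have D: "((\<lambda>x. of_real a * x * (1 - x) powr (of_real a - 1) * F (?z x) + (1 - x) powr of_real a * p (?z x)) has_field_derivative
        of_real (a ^ 2) * (1 - x) powr (2 * of_real a - 1) * y x) (at x)"
    proof -
      \<comment> \<open>All powers of 1 - x are reduced to u times integer powers, which leaves a
        rational identity.\<close>
      define u where "u = (1 - x) powr of_real a"
      have pw: "(1 - x) powr (2 * of_real a - 1) = u * u / (1 - x)" "(1 - x) powr (of_real a - 1) = u / (1 - x)"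
        "(1 - x) powr (of_real a - 2) = u / (1 - x) ^ 2"
        "(1 - x) powr (- of_real a) = 1 / u" "u \<noteq> 0"
        using S[OF x] by (simp_all add: u_def powr_diff powr_minus_divide power2_eq_square flip: powr_add)
      have pd: "((\<lambda>x. (1 - x) powr c) has_field_derivative - c * (1 - x) powr (c - 1)) (at x)" for c
        by (rule DERIV_cong, (rule derivative_eq_intros refl S[OF x])+) simp
      have 1: "((\<lambda>x. of_real a * x * (1 - x) powr (of_real a - 1)) has_field_derivative
            of_real a * u / (1 - x) + (1 - of_real a) * (u / (1 - x) ^ 2) * (of_real a * x)) (at x)"
        by (rule DERIV_cong[OF DERIV_mult[OF DERIV_cmult[OF DERIV_ident] pd]])
           (simp add: pw(2,3))
      have 2: "((\<lambda>x. (1 - x) powr of_real a) has_field_derivative - of_real a * (u / (1 - x))) (at x)"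
        using pd[of "of_real a"] unfolding pw .
      show ?thesis
        by (rule DERIV_cong[OF DERIV_add[OF DERIV_mult[OF 1 Fz[OF x]] DERIV_mult[OF 2 pz[OF x]]]],
            unfold y_def pw p_def u_def[symmetric])
           (use pw(5) S[OF x] in \<open>simp add: divide_simps power2_eq_square; simp add: algebra_simps\<close>)
    qed
    show "((\<lambda>x. x * (1 - x) powr (2 * of_real a) * y' x) has_field_derivative of_real (a ^ 2) * (1 - x) powr (2 * of_real a - 1) * y x) (at x within S)"
      by (rule has_field_derivative_at_within, rule has_field_derivative_transform_within_open[OF D _ x Py'[symmetric]])
         (simp_all add: S_def)
  next
    show "x * (1 - x) powr (2 * of_real a) \<noteq> 0" if "x \<in> S" "x \<noteq> 0" for x
      using S[OF that(1)] that(2) by simp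
  qed (use x in \<open>auto simp: S_def y_def F_def\<close>)
  thus ?thesis by (simp add: y_def F_def)
qed

section \<open>The generating function of the inner sums\<close>

text \<open>The binomial of -a over k equals (-1)^k times the Pochhammer symbol of a divided by k!,
  and squaring removes the sign; the inner sum is then a Cauchy product.\<close>

lemma hyp_fps_mult_nth:
  "fps_nth (hyp_fps a a * hyp_fps b b) n =
     of_real (\<Sum>k=0..n. ((- a) gchoose k)^2 * ((- b) gchoose (n - k))^2)"
proof -
  have "fps_nth (hyp_fps c c) k = of_real (((- c) gchoose k) ^ 2)" for c :: real and k
    by (simp add: hyp_fps_def gbinomial_pochhammer power_mult_distrib power_divide power2_eq_square
        del: of_real_mult of_real_divide flip: power_mult)
  thus ?thesis by (simp add: fps_mult_nth)
qed

lemma hyp_commute: "hyp a b = hyp b a"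
  by (simp add: hyp_def hyp_fps_def mult.commute)

text \<open>Pfaff for a and for 1 - a leads to the same function by symmetry in the parameters, and
  the exponents -a and -(1 - a) add up to -1.\<close>

lemma hyp_product:
  assumes "0 < a" "a < 1" "norm x < 1 / 2"
  shows "hyp a a x * hyp (1 - a) (1 - a) x = hyp a (1 - a) (x / (x - 1)) ^ 2 / (1 - x)"
proof -
  have "x \<noteq> 1" using assms by auto
  hence *: "(1 - x) powr (- of_real a) * (1 - x) powr (- of_real (1 - a)) = 1 / (1 - x)"
    by (subst powr_add[symmetric]) (simp add: powr_minus_divide)
  have "hyp a a x * hyp (1 - a) (1 - a) x = 
     ((1 - x) powr (- of_real a) * (1 - x) powr (- of_real (1 - a))) * hyp a (1 - a) (x / (x - 1)) ^ 2"
    using hyp_Pfaff[of a x] hyp_Pfaff[of "1 - a" x] assms hyp_commute[of "1 - a" a]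
    by (simp add: power2_eq_square)
  thus ?thesis unfolding * by simp
qed

text \<open>If g is the generating function, the series is \<open>\<alpha>\<close> x g'(x) +
  \<open>\<beta>\<close> g(x). The closed form of g from \<open>hyp_product\<close> is
  differentiated by the chain rule, with dz/dx = -1 / (1 - x)^2.\<close>

lemma product_series_sums:
  fixes a x \<alpha> \<beta> :: real
  assumes a: "0 < a" "a < 1" and x: "\<bar>x\<bar> < 1 / 2"
  defines "z \<equiv> complex_of_real (x / (x - 1))"
  defines "F \<equiv> hyp a (1 - a) z" and "F' \<equiv> hyp' a (1 - a) z"
  shows "(\<lambda>n. complex_of_real ((\<alpha> * n + \<beta>) * x ^ n * 
            (\<Sum>k=0..n. ((- a) gchoose k)^2 * ((a - 1) gchoose (n - k))^2)))
           sums (of_real (\<alpha> * x) * (F ^ 2 / of_real (1 - x) ^ 2 - 2 * F * F' / of_real (1 - x) ^ 3)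
                  + of_real \<beta> * F ^ 2 / of_real (1 - x))"
proof -
  define g where "g = hyp_fps a a * hyp_fps (1 - a) (1 - a)"
  let ?x = "complex_of_real x"
  have r: "fps_conv_radius g \<ge> 1"
    using fps_conv_radius_mult[of "hyp_fps a a" "hyp_fps (1 - a) (1 - a)"]
      fps_conv_radius_hyp[of a a] fps_conv_radius_hyp[of "1 - a" "1 - a"] a
    unfolding g_def by (auto simp: min_def split: if_splits)
  have r0: "ereal (norm y) < fps_conv_radius g" if "norm y < 1" for y :: complex
    using r that by (meson ereal_less(3) less_le_trans)
  have r1: "ereal (norm ?x) < fps_conv_radius (fps_deriv g)"
    using r0[of ?x] fps_conv_radius_deriv[of g] x by (simp add: less_le_trans)
  have r2: "ereal (norm ?x) < fps_conv_radius (fps_X * fps_deriv g)"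
    using r1 fps_conv_radius_mult[of fps_X "fps_deriv g"] by (simp add: less_le_trans)
  have eq: "eval_fps g y = hyp a (1 - a) (y / (y - 1)) ^ 2 / (1 - y)" if "y \<in> ball 0 (1 / 2)" for y
    using hyp_product[OF a, of y] norm_less_hyp_conv_radius[of a a y] norm_less_hyp_conv_radius[of "1 - a" "1 - a" y] a that
    unfolding g_def by (simp add: eval_fps_mult hyp_def)
  have x1: "?x \<noteq> 1" using x by auto
  have z: "z = ?x / (?x - 1)" by (simp add: z_def)
  have "norm z < 1"
    using x unfolding z_def norm_of_real abs_divide by (subst divide_less_eq_1_pos) auto
  hence "(hyp a (1 - a) has_field_derivative F') (at z)"
    unfolding F'_def using a by (intro has_field_derivative_hyp) auto
  moreover have "((\<lambda>y. y / (y - 1)) has_field_derivative (- 1 / (1 - ?x) ^ 2)) (at ?x)"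
    using x1 by (auto intro!: derivative_eq_intros simp: divide_simps power2_eq_square; simp add: algebra_simps)
  ultimately have d1: "((\<lambda>y. hyp a (1 - a) (y / (y - 1))) has_field_derivative F' * (- 1 / (1 - ?x) ^ 2)) (at ?x)"
    unfolding z by (rule DERIV_chain2)
  have "((\<lambda>y. hyp a (1 - a) (y / (y - 1)) ^ 2 / (1 - y)) has_field_derivative
           F ^ 2 / (1 - ?x) ^ 2 - 2 * F * F' / (1 - ?x) ^ 3) (at ?x)"
    apply (rule DERIV_cong, (rule derivative_intros d1)+)
     apply (use x1 in simp)
    apply (unfold z[symmetric] F_def[symmetric])
    using x1 by (simp add: divide_simps power2_eq_square power3_eq_cube)
  hence "(eval_fps g has_field_derivative F ^ 2 / (1 - ?x) ^ 2 - 2 * F * F' / (1 - ?x) ^ 3) (at ?x)"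
    by (rule has_field_derivative_transform_within_open[where S = "ball 0 (1 / 2)"])
       (use x eq in auto)
  moreover have "(eval_fps g has_field_derivative eval_fps (fps_deriv g) ?x) (at ?x)"
    by (rule has_field_derivative_eval_fps) (use r0[of ?x] x in simp)
  ultimately have d: "eval_fps (fps_deriv g) ?x = F ^ 2 / (1 - ?x) ^ 2 - 2 * F * F' / (1 - ?x) ^ 3"
    using DERIV_unique by blast
  have "(\<lambda>n. fps_nth (fps_X * fps_deriv g) n * ?x ^ n) sums eval_fps (fps_X * fps_deriv g) ?x"
    by (rule sums_eval_fps r2)+
  moreover have "fps_nth (fps_X * fps_deriv g) n = of_nat n * fps_nth g n" for n
    by (cases n) simp_all
  moreover have "eval_fps (fps_X * fps_deriv g) ?x = ?x * eval_fps (fps_deriv g) ?x"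
    using r1 by (subst eval_fps_mult) auto
  ultimately have s1: "(\<lambda>n. of_nat n * fps_nth g n * ?x ^ n) sums (?x * (F ^ 2 / (1 - ?x) ^ 2 - 2 * F * F' / (1 - ?x) ^ 3))"
    by (simp add: d)
  have s2: "(\<lambda>n. fps_nth g n * ?x ^ n) sums (F ^ 2 / (1 - ?x))"
    using sums_eval_fps[of ?x g] r0[of ?x] x eq[of ?x] by (simp add: F_def z)
  have "fps_nth g n = of_real (\<Sum>k=0..n. ((- a) gchoose k)^2 * ((a - 1) gchoose (n - k))^2)" for n
    using hyp_fps_mult_nth[of a "1 - a" n] by (simp add: g_def)
  thus ?thesis
    using sums_add[OF sums_mult[OF s1, of "of_real \<alpha>"] sums_mult[OF s2, of "of_real \<beta>"]]
    by (simp add: algebra_simps del: of_real_sum)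
qed

section \<open>The involution and the differential equation\<close>

text \<open>If \<open>w^2\<close> is the Hauptmodul of \<open>\<Gamma>\<^sub>0(2)\<close> at \<open>\<tau>\<close>, then \<open>(fricke w)^2\<close> is its value at \<open>-1/\<tau>\<close>.\<close>
definition fricke :: "complex \<Rightarrow> complex" where
  "fricke w = (1 - w) / (1 + 3 * w)"

text \<open>The function \<open>h\<close> is left open because two choices occur:
  \<open>hyp4\<close> itself gives the second solution for the Wronskian, and
  \<open>hyp4 (1 - y)\<close> gives the quadratic transformation.\<close>

definition twist :: "(complex \<Rightarrow> complex) \<Rightarrow> complex \<Rightarrow> complex" where
  "twist h w = h (fricke w ^ 2) / csqrt (1 + 3 * w)"

definition twist' :: "(complex \<Rightarrow> complex) \<Rightarrow> (complex \<Rightarrow> complex) \<Rightarrow> complex \<Rightarrow> complex" where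
  "twist' h h' w = - (3 / 2) * h (fricke w ^ 2) / csqrt (1 + 3 * w) ^ 3
      - 8 * fricke w * h' (fricke w ^ 2) / csqrt (1 + 3 * w) ^ 5"

text \<open>With s = sqrt(1 + 3w) as parameter, both w and \<open>fricke w\<close> are rational in
  s, so the identities below become rational ones.\<close>

lemma csqrt_param:
  fixes w s :: complex
  assumes w: "Re (1 + 3 * w) > 0"
  defines "s \<equiv> csqrt (1 + 3 * w)"
  shows "1 + 3 * w \<notin> \<real>\<^sub>\<le>\<^sub>0" "1 + 3 * w = s ^ 2" "s \<noteq> 0" "w = (s ^ 2 - 1) / 3"
    "fricke w = (4 - s ^ 2) / (3 * s ^ 2)"
proof -
  show "1 + 3 * w \<notin> \<real>\<^sub>\<le>\<^sub>0" using w by (auto simp: complex_nonpos_Reals_iff)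
  thus 0: "s \<noteq> 0" unfolding s_def by auto
  show 1: "1 + 3 * w = s ^ 2" by (simp add: s_def)
  thus 2: "w = (s ^ 2 - 1) / 3" by (simp add: field_simps)
  show "fricke w = (4 - s ^ 2) / (3 * s ^ 2)"
    unfolding fricke_def 1 using 0 by (simp add: 2 field_simps)
qed

text \<open>With y = (fricke w)^2 and dy/dw = -8 fricke w / s^4, this says that w (1 - w^2) dy/dw =
  - s^2 y (1 - y): the substitution matches the leading coefficients of the two self-adjoint
  equations.\<close>

lemma twist_identity:
  assumes "Re (1 + 3 * w) > 0"
  shows "8 * (w * (1 - w ^ 2)) * fricke w / csqrt (1 + 3 * w) ^ 5 = csqrt (1 + 3 * w) * (fricke w ^ 2 * (1 - fricke w ^ 2))"
proof -
  define s where "s = csqrt (1 + 3 * w)"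
  note aux = csqrt_param[OF assms, folded s_def]
  show ?thesis unfolding s_def[symmetric]
    using aux(3) unfolding aux(5)
    by (subst (1 2) aux(4)) (simp add: divide_simps, simp add: algebra_simps power_eq_if)
qed

lemma twist'_altdef:
  assumes "Re (1 + 3 * w) > 0"
  shows "w * (1 - w ^ 2) * twist' h h' w =
      - (3 / 2) * (w * (1 - w ^ 2) / csqrt (1 + 3 * w) ^ 3) * h (fricke w ^ 2)
      - csqrt (1 + 3 * w) * (fricke w ^ 2 * (1 - fricke w ^ 2) * h' (fricke w ^ 2))"
proof -
  have "P * (- (3 / 2) * H / s ^ 3 - 8 * v * K / s ^ 5) = - (3 / 2) * (P / s ^ 3) * H - 8 * P * v / s ^ 5 * K"
    for P H K v s :: complex by (simp add: right_diff_distrib mult_ac)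
  hence "w * (1 - w ^ 2) * twist' h h' w = - (3 / 2) * (w * (1 - w ^ 2) / csqrt (1 + 3 * w) ^ 3) * h (fricke w ^ 2)
        - 8 * (w * (1 - w ^ 2)) * fricke w / csqrt (1 + 3 * w) ^ 5 * h' (fricke w ^ 2)"
    unfolding twist'_def .
  thus ?thesis
    unfolding twist_identity[OF assms] by (simp only: mult.assoc)
qed

context
  fixes w s :: complex
  assumes w: "Re (1 + 3 * w) > 0"
  defines "s \<equiv> csqrt (1 + 3 * w)"
begin

lemmas csqrt_param_w = csqrt_param[OF w, folded s_def]

lemma csqrt_deriv: "((\<lambda>w. csqrt (1 + 3 * w)) has_field_derivative 3 / (2 * s)) (at w)"
  by (rule DERIV_cong, (rule derivative_eq_intros refl csqrt_param_w)+) (simp add: s_def field_simps)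

lemma fricke_deriv: "((\<lambda>w. fricke w ^ 2) has_field_derivative - 8 * fricke w / s ^ 4) (at w)"
proof -
  have "(fricke has_field_derivative - 4 / s ^ 4) (at w)"
    unfolding fricke_def[abs_def]
  proof (rule DERIV_cong[OF DERIV_divide])
    show "((\<lambda>w. 1 - w) has_field_derivative - 1) (at w)" "((\<lambda>w. 1 + 3 * w) has_field_derivative 3) (at w)"
      by (auto intro!: derivative_eq_intros)
    show "1 + 3 * w \<noteq> 0" using csqrt_param_w(2,3) by simp
    show "(- 1 * (1 + 3 * w) - (1 - w) * 3) / ((1 + 3 * w) * (1 + 3 * w)) = - 4 / s ^ 4"
      unfolding csqrt_param_w(2) by (subst csqrt_param_w(4)) (simp add: field_simps power4_eq_xxxx power2_eq_square)
  qed
  from DERIV_power[OF this, of 2] show ?thesis by simp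
qed

lemma has_field_derivative_twist:
  assumes "(h has_field_derivative h' (fricke w ^ 2)) (at (fricke w ^ 2))"
  shows "(twist h has_field_derivative twist' h h' w) (at w)"
  unfolding twist_def[abs_def] twist'_def s_def[symmetric]
  by (rule DERIV_cong[OF DERIV_divide[OF DERIV_chain2[OF assms fricke_deriv] csqrt_deriv]], unfold s_def[symmetric])
     (use csqrt_param_w(3) in \<open>simp_all add: field_simps power_eq_if\<close>)

text \<open>Differentiating the form in \<open>twist'_altdef\<close> requires only the derivative of
  y (1 - y) h'(y), which is assumption \<open>p\<close>. The terms with h' cancel, and those with h
  combine to the right-hand side.\<close>

lemma twist_self_adjoint:
  assumes h: "(h has_field_derivative h' (fricke w ^ 2)) (at (fricke w ^ 2))"
    and p: "((\<lambda>y. y * (1 - y) * h' y) has_field_derivative 3 / 16 * h (fricke w ^ 2)) (at (fricke w ^ 2))"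
  shows "((\<lambda>w. w * (1 - w ^ 2) * twist' h h' w) has_field_derivative 3 / 4 * w * twist h w) (at w)"
proof -
  define p where "p y = y * (1 - y) * h' y" for y
  define H where "H = h (fricke w ^ 2)"
  define K where "K = h' (fricke w ^ 2)"
  have ph: "((\<lambda>w. h (fricke w ^ 2)) has_field_derivative K * (- 8 * fricke w / s ^ 4)) (at w)"
    unfolding K_def by (rule DERIV_chain2[OF h fricke_deriv])
  have pp: "((\<lambda>w. p (fricke w ^ 2)) has_field_derivative (3 / 16 * H) * (- 8 * fricke w / s ^ 4)) (at w)"
    unfolding H_def p_def by (rule DERIV_chain2[OF p fricke_deriv])
  have c: "((\<lambda>w. w * (1 - w ^ 2) / csqrt (1 + 3 * w) ^ 3) has_field_derivative
         (1 - 3 * w ^ 2) / s ^ 3 - (9 / 2) * w * (1 - w ^ 2) / s ^ 5) (at w)"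
  proof (rule DERIV_cong[OF DERIV_divide])
    show "((\<lambda>w. w * (1 - w ^ 2)) has_field_derivative (1 - 3 * w ^ 2)) (at w)"
      by (auto intro!: derivative_eq_intros simp: power2_eq_square algebra_simps)
    show "((\<lambda>w. csqrt (1 + 3 * w) ^ 3) has_field_derivative 3 * s ^ 2 * (3 / (2 * s))) (at w)"
      using DERIV_power[OF csqrt_deriv, of 3] by (simp add: s_def)
  qed (use csqrt_param_w(3) in \<open>auto simp: s_def[symmetric] divide_simps power_eq_if\<close>, simp add: algebra_simps)
  show ?thesis
  proof (rule has_field_derivative_transform_within_open[OF _ _ _ twist'_altdef[symmetric]])
    show "open {w. Re (1 + 3 * w) > 0}"
      by (intro open_Collect_less continuous_intros)
    show "((\<lambda>w. - (3 / 2) * (w * (1 - w ^ 2) / csqrt (1 + 3 * w) ^ 3) * h (fricke w ^ 2) - csqrt (1 + 3 * w) * (fricke w ^ 2 * (1 - fricke w ^ 2) * h' (fricke w ^ 2)))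
        has_field_derivative 3 / 4 * w * twist h w) (at w)"
    proof (rule DERIV_cong[OF DERIV_diff[OF DERIV_mult[OF DERIV_cmult[OF c] ph] DERIV_mult[OF csqrt_deriv pp[unfolded p_def]]]],
           fold H_def s_def p_def)
      have s: "s \<noteq> 0" by (rule csqrt_param_w)
      have v: "fricke w = (1 - w) / s ^ 2"
        by (simp add: fricke_def csqrt_param_w(2))
      \<comment> \<open>This collects the coefficient of H; after substituting s^2 = 1 + 3w its
        numerator is (3/4) w s^4.\<close>
      have "- (3 / 2) * ((1 - 3 * w ^ 2) / s ^ 3 - 9 / 2 * w * (1 - w ^ 2) / s ^ 5) + (3 / 2) * fricke w / s ^ 3 =
          (- (3 / 2) * ((1 - 3 * w ^ 2) * s ^ 2 - 9 / 2 * w * (1 - w ^ 2)) + (3 / 2) * (1 - w)) / s ^ 5"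
        using s unfolding v by (simp add: divide_simps) (simp add: algebra_simps power_eq_if)
      also have "- (3 / 2) * ((1 - 3 * w ^ 2) * s ^ 2 - 9 / 2 * w * (1 - w ^ 2)) + (3 / 2) * (1 - w) = 3 / 4 * w * (s ^ 2) ^ 2"
        unfolding csqrt_param_w(2)[symmetric] by (simp add: field_simps power_eq_if)
      also have "3 / 4 * w * (s ^ 2) ^ 2 / s ^ 5 = 3 / 4 * w / s"
        using s by (simp add: field_simps power_eq_if)
      finally have cH: "- (3 / 2) * ((1 - 3 * w ^ 2) / s ^ 3 - 9 / 2 * w * (1 - w ^ 2) / s ^ 5) * H + (3 / 2) * fricke w / s ^ 3 * H
          = 3 / 4 * w / s * H"
        by (simp only: flip: distrib_right)
      \<comment> \<open>By \<open>twist_identity\<close>, the term with K from differentiating h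
        cancels the one from differentiating the square root.\<close>
      have "(3 / 2) * (8 * (w * (1 - w ^ 2)) * fricke w / s ^ 5) / s ^ 2 * K = 3 / 2 / s * (fricke w ^ 2 * (1 - fricke w ^ 2) * K)"
        unfolding twist_identity[OF w, folded s_def] using s by (simp add: power2_eq_square)
      hence cK: "K * (- 8 * fricke w / s ^ 4) * (- (3 / 2) * (w * (1 - w ^ 2) / s ^ 3)) = 3 / (2 * s) * p (fricke w ^ 2)"
        unfolding p_def K_def[symmetric] using s by (simp add: field_simps power_eq_if)
      have cs: "3 / 16 * H * (- 8 * fricke w / s ^ 4) * s = - ((3 / 2) * fricke w / s ^ 3 * H)"
        using s by (simp add: field_simps power_eq_if)
      show "- (3 / 2) * ((1 - 3 * w ^ 2) / s ^ 3 - 9 / 2 * w * (1 - w ^ 2) / s ^ 5) * H +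
          K * (- 8 * fricke w / s ^ 4) * (- (3 / 2) * (w * (1 - w ^ 2) / s ^ 3)) -
          (3 / (2 * s) * p (fricke w ^ 2) + 3 / 16 * H * (- 8 * fricke w / s ^ 4) * s) = 3 / 4 * w * twist h w"
        unfolding cK cs using cH by (simp add: twist_def H_def s_def)
    qed
  qed (use w in auto)
qed

end

section \<open>The Wronskian constant\<close>

text \<open>The weights (1 - y) y^n have total mass 1 and move to infinity as y tends to 1. The
  first N terms contribute at most (1 - y) K to the error, the others at most e/2.\<close>

lemma abel_limit:
  fixes b :: "nat \<Rightarrow> complex"
  assumes b: "b \<longlonglongrightarrow> c"
  shows "((\<lambda>y::real. of_real (1 - y) * (\<Sum>n. b n * of_real y ^ n)) \<longlongrightarrow> c) (at_left 1)"
proof (rule tendstoI)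
  fix e :: real assume e: "e > 0"
  obtain N where N: "\<And>n. n \<ge> N \<Longrightarrow> norm (b n - c) < e / 2"
    using LIMSEQ_D[OF b, of "e / 2"] e by auto
  define K where "K = (\<Sum>n<N. norm (b n - c))"
  have K: "K \<ge> 0" unfolding K_def by (intro sum_nonneg) auto
  obtain B where B: "\<And>n. norm (b n) \<le> B"
    using Bseq_def convergent_imp_Bseq b convergent_def by metis
  have "eventually (\<lambda>y. y \<in> {max 0 (1 - e / (2 * (K + 1))) <..< 1}) (at_left (1::real))"
    using e K by (intro eventually_at_left_real) (auto simp: field_simps)
  thus "eventually (\<lambda>y. dist (of_real (1 - y) * (\<Sum>n. b n * of_real y ^ n)) c < e) (at_left (1::real))"
  proof eventually_elim
    case (elim y)
    hence y: "0 < y" "y < 1" "(1 - y) * (K + 1) < e / 2"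
      using K by (auto simp: field_simps)
    have geo: "(\<lambda>n. complex_of_real y ^ n) sums (1 / (1 - of_real y))"
      using y by (intro geometric_sums) auto
    have "summable (\<lambda>n. b n * of_real y ^ n)"
    proof (rule summable_comparison_test)
      show "\<exists>N. \<forall>n\<ge>N. norm (b n * complex_of_real y ^ n) \<le> B * y ^ n"
        using B y by (auto simp: norm_mult norm_power intro!: mult_right_mono)
      show "summable (\<lambda>n. B * y ^ n)"
        using y by (intro summable_mult summable_geometric) auto
    qed
    hence "(\<lambda>n. b n * of_real y ^ n) sums (\<Sum>n. b n * of_real y ^ n)" by (rule summable_sums)
    from sums_diff[OF this sums_mult[OF geo, of c]]
    have s1: "(\<lambda>n. (b n - c) * of_real y ^ n) sums ((\<Sum>n. b n * of_real y ^ n) - c / (1 - of_real y))"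
      by (simp add: algebra_simps)
    have "(\<lambda>n. (if n \<in> {..<N} then norm (b n - c) else 0)) sums K"
      unfolding K_def by (rule sums_If_finite_set) simp
    moreover have "(\<lambda>n. e / 2 * y ^ n) sums (e / 2 * (1 / (1 - y)))"
      using y by (intro sums_mult geometric_sums) auto
    ultimately have s2: "(\<lambda>n. (if n \<in> {..<N} then norm (b n - c) else 0) + e / 2 * y ^ n) sums (K + e / 2 * (1 / (1 - y)))"
      by (rule sums_add)
    have "norm ((b n - c) * of_real y ^ n) \<le> (if n \<in> {..<N} then norm (b n - c) else 0) + e / 2 * y ^ n" for n
    proof (cases "n < N")
      case True
      have "norm (b n - c) * y ^ n \<le> norm (b n - c)"
        using y by (intro mult_right_le_one_le power_le_one) auto
      thus ?thesis using True y e by (simp add: norm_mult norm_power add_increasing2)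
    next
      case False
      have "norm (b n - c) * y ^ n \<le> e / 2 * y ^ n"
        using y N[of n] False by (intro mult_right_mono) auto
      thus ?thesis using False y by (simp add: norm_mult norm_power)
    qed
    hence "norm ((\<Sum>n. b n * of_real y ^ n) - c / (1 - of_real y)) \<le> K + e / 2 * (1 / (1 - y))"
      using norm_suminf_le[OF _ sums_summable[OF s2]] s1 s2 by (metis (no_types, lifting) sums_unique)
    hence "(1 - y) * norm ((\<Sum>n. b n * of_real y ^ n) - c / (1 - of_real y)) \<le> (1 - y) * (K + e / 2 * (1 / (1 - y)))"
      using y by (intro mult_left_mono) auto
    also have "\<dots> = (1 - y) * K + e / 2" using y by (simp add: field_simps)
    also have "\<dots> < e" using y K by (simp add: algebra_simps)
    also have "(1 - y) * norm ((\<Sum>n. b n * of_real y ^ n) - c / (1 - of_real y)) =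
        norm (of_real (1 - y) * ((\<Sum>n. b n * of_real y ^ n) - c / (1 - of_real y)))"
      using y by (simp only: norm_mult norm_of_real)
    also have "of_real (1 - y) * ((\<Sum>n. b n * of_real y ^ n) - c / (1 - of_real y)) =
        of_real (1 - y) * (\<Sum>n. b n * of_real y ^ n) - c"
      using y by (simp add: right_diff_distrib)
    finally show ?case by (simp add: dist_norm)
  qed
qed

text \<open>The quantity is the reciprocal of a product of two sequences converging to Gamma(a) and
  Gamma(1 - a), because n^a n^(1-a) = n; the reflection formula evaluates the limit.\<close>

lemma hyp_fps_nth_asymp:
  assumes a: "0 < a" "a < 1"
  shows "(\<lambda>n. of_nat n * fps_nth (hyp_fps a (1 - a)) n) \<longlonglongrightarrow> of_real (sin (pi * a) / pi)"
proof -
  have "complex_of_real (Gamma a * Gamma (1 - a)) = of_real (pi / sin (pi * a))"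
  proof -
    have "sin (of_real pi * complex_of_real a) = of_real (sin (pi * a))"
      by (simp only: sin_of_real of_real_mult flip: of_real_mult)
    moreover have "1 - complex_of_real a = of_real (1 - a)" by simp
    ultimately show ?thesis
      using Gamma_reflection_complex[of "of_real a"] by (simp only: Gamma_complex_of_real of_real_mult of_real_divide)
  qed
  hence G: "Gamma a * Gamma (1 - a) = pi / sin (pi * a)"
    by (simp only: of_real_eq_iff)
  have "sin (pi * a) > 0" using a by (intro sin_gt_zero) auto
  hence "(\<lambda>n. 1 / (Gamma_series' a n * Gamma_series' (1 - a) n)) \<longlonglongrightarrow> 1 / (Gamma a * Gamma (1 - a))"
    using G by (intro tendsto_intros Gamma_series'_LIMSEQ) auto
  hence lim: "(\<lambda>n. 1 / (Gamma_series' a n * Gamma_series' (1 - a) n)) \<longlonglongrightarrow> sin (pi * a) / pi"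
    by (simp add: G)
  have "eventually (\<lambda>n. 1 / (Gamma_series' a n * Gamma_series' (1 - a) n) =
     real n * (pochhammer a n * pochhammer (1 - a) n / fact n ^ 2)) sequentially"
    using eventually_gt_at_top[of "0::nat"]
  proof eventually_elim
    case (elim n)
    then obtain m where n: "n = Suc m" by (cases n) auto
    have "exp (a * ln (real n)) * exp ((1 - a) * ln (real n)) = real n"
      using elim by (simp add: algebra_simps flip: exp_add)
    hence "Gamma_series' a n * Gamma_series' (1 - a) n = fact m ^ 2 * real n / (pochhammer a n * pochhammer (1 - a) n)"
      by (simp add: Gamma_series'_def n power2_eq_square mult_ac)
    moreover have "fact n = real n * fact m" by (simp add: n)
    ultimately show ?case using elim by (simp add: power2_eq_square del: of_nat_Suc)
  qed
  hence "(\<lambda>n. real n * (pochhammer a n * pochhammer (1 - a) n / fact n ^ 2)) \<longlonglongrightarrow> sin (pi * a) / pi"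
    using lim by (rule Lim_transform_eventually[rotated])
  hence "(\<lambda>n. complex_of_real (real n * (pochhammer a n * pochhammer (1 - a) n / fact n ^ 2))) \<longlonglongrightarrow> of_real (sin (pi * a) / pi)"
    by (rule tendsto_of_real)
  thus ?thesis by (simp add: hyp_fps_def)
qed

text \<open>Both limits follow from \<open>abel_limit\<close>: the coefficients of the series tend
  to 0, and those of its derivative are the shifted sequence (n + 1) E(n + 1) of
  \<open>hyp_fps_nth_asymp\<close>.\<close>

lemma hyp_at_left_1:
  assumes a: "0 < a" "a < 1"
  shows "((\<lambda>y. of_real (1 - y) * hyp a (1 - a) (of_real y)) \<longlongrightarrow> 0) (at_left 1)"
    and "((\<lambda>y. of_real (1 - y) * hyp' a (1 - a) (of_real y)) \<longlongrightarrow> of_real (sin (pi * a) / pi)) (at_left 1)"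
proof -
  let ?E = "fps_nth (hyp_fps a (1 - a))"
  have lim: "(\<lambda>n. of_nat n * ?E n) \<longlonglongrightarrow> of_real (sin (pi * a) / pi)"
    by (rule hyp_fps_nth_asymp[OF a])
  have "(\<lambda>n. (of_nat n * ?E n) * (1 / of_nat n)) \<longlonglongrightarrow> of_real (sin (pi * a) / pi) * 0"
    by (intro tendsto_mult lim lim_1_over_n)
  moreover have "eventually (\<lambda>n. (of_nat n * ?E n) * (1 / of_nat n) = ?E n) sequentially"
    using eventually_gt_at_top[of "0::nat"] by eventually_elim simp
  ultimately have "?E \<longlonglongrightarrow> of_real (sin (pi * a) / pi) * 0"
    by (rule Lim_transform_eventually)
  hence "?E \<longlonglongrightarrow> 0" by simp
  from abel_limit[OF this]
  show "((\<lambda>y. of_real (1 - y) * hyp a (1 - a) (of_real y)) \<longlongrightarrow> 0) (at_left 1)"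
    by (simp add: hyp_def eval_fps_def)
  from abel_limit[OF LIMSEQ_Suc[OF lim]]
  show "((\<lambda>y. of_real (1 - y) * hyp' a (1 - a) (of_real y)) \<longlongrightarrow> of_real (sin (pi * a) / pi)) (at_left 1)"
    by (simp add: hyp'_def eval_fps_def)
qed

section \<open>The Wronskian of the two solutions for the parameters 1/4 and 3/4\<close>

abbreviation "hyp4 \<equiv> hyp (1 / 4) (3 / 4)"
abbreviation "hyp4' \<equiv> hyp' (1 / 4) (3 / 4)"

lemma hyp4_deriv: "norm z < 1 \<Longrightarrow> (hyp4 has_field_derivative hyp4' z) (at z)"
  by (rule has_field_derivative_hyp) auto

lemma hyp4_self_adjoint:
  "norm z < 1 \<Longrightarrow> ((\<lambda>z. z * (1 - z) * hyp4' z) has_field_derivative 3 / 16 * hyp4 z) (at z)"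
  using hyp_self_adjoint[of "1/4" z] by simp

lemma hyp4_square_deriv:
  assumes "norm w < 1"
  shows "((\<lambda>w. hyp4 (w ^ 2)) has_field_derivative 2 * w * hyp4' (w ^ 2)) (at w)"
    and "((\<lambda>w. w * (1 - w ^ 2) * (2 * w * hyp4' (w ^ 2))) has_field_derivative 3 / 4 * w * hyp4 (w ^ 2)) (at w)"
proof -
  have n: "norm (w ^ 2) < 1" using assms by (simp add: norm_power power_less_one_iff)
  have d: "((\<lambda>w. w ^ 2) has_field_derivative 2 * w) (at w)"
    by (auto intro!: derivative_eq_intros)
  show "((\<lambda>w. hyp4 (w ^ 2)) has_field_derivative 2 * w * hyp4' (w ^ 2)) (at w)"
    using DERIV_chain2[OF hyp4_deriv[OF n] d] by (simp add: mult_ac)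
  have "((\<lambda>w. 2 * (w ^ 2 * (1 - w ^ 2) * hyp4' (w ^ 2))) has_field_derivative 3 / 4 * w * hyp4 (w ^ 2)) (at w)"
    by (rule DERIV_cong[OF DERIV_cmult[OF DERIV_chain2[OF hyp4_self_adjoint[OF n] d]]]) simp
  thus "((\<lambda>w. w * (1 - w ^ 2) * (2 * w * hyp4' (w ^ 2))) has_field_derivative 3 / 4 * w * hyp4 (w ^ 2)) (at w)"
    by (simp add: mult_ac power2_eq_square)
qed

text \<open>The difference |1 + 3w|^2 - |1 - w|^2 equals 8 (Re w + |w|^2).\<close>

lemma norm_fricke_less_1:
  assumes "Re w \<ge> 0" "w \<noteq> 0"
  shows "norm (fricke w) < 1"
proof -
  have "Re w + (Re w ^ 2 + Im w ^ 2) > 0"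
    using assms by (simp add: complex_eq_iff sum_power2_gt_zero_iff add_nonneg_pos)
  hence "norm (1 - w) ^ 2 < norm (1 + 3 * w) ^ 2"
    unfolding cmod_power2 by (simp add: power2_eq_square algebra_simps)
  hence "norm (1 - w) < norm (1 + 3 * w)"
    by (rule power_less_imp_less_base) simp
  thus ?thesis unfolding fricke_def norm_divide by (subst divide_less_eq_1_pos) (auto intro: le_less_trans[of 0])
qed

text \<open>The Wronskian carries the factor w (1 - w^2), which makes it constant; the grouping puts
  the derivatives in the form in which the self-adjoint equation differentiates them.\<close>

definition wronskian_hyp4 :: "complex \<Rightarrow> complex" where
  "wronskian_hyp4 w = hyp4 (w ^ 2) * (w * (1 - w ^ 2) * twist' hyp4 hyp4' w) - w * (1 - w ^ 2) * (2 * w * hyp4' (w ^ 2)) * twist hyp4 w"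

text \<open>As t decreases to 0, r = (fricke t)^2 tends to 1 from below. Only the term with (1 - r)
  hyp4'(r) survives, and it tends to sin(pi/4) / pi.\<close>

lemma wronskian_hyp4_tendsto:
  "((\<lambda>t. wronskian_hyp4 (of_real t)) \<longlongrightarrow> - of_real (1 / (pi * sqrt 2))) (at_right 0)"
proof -
  define r where "r t = ((1 - t) / (1 + 3 * t)) ^ 2" for t :: real
  have ev: "eventually (\<lambda>t::real. t \<in> {0<..<1}) (at_right 0)"
    by (rule eventually_at_right_real) simp
  have "(r \<longlongrightarrow> ((1 - 0) / (1 + 3 * 0)) ^ 2) (at_right 0)"
    unfolding r_def[abs_def] by (intro tendsto_intros) auto
  hence fl: "filterlim r (at_left 1) (at_right 0)"
    unfolding filterlim_at
  proof (intro conjI)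
    show "\<forall>\<^sub>F t in at_right 0. r t \<in> {..<1} \<and> r t \<noteq> 1"
      using ev
    proof eventually_elim
      case (elim t)
      have "((1 - t) / (1 + 3 * t)) ^ 2 < 1 ^ 2"
        using elim by (intro power_strict_mono) (auto simp: field_simps)
      thus ?case by (simp add: r_def)
    qed
  qed simp
  have lim0: "((\<lambda>t. of_real (1 - r t) * hyp4 (of_real (r t))) \<longlongrightarrow> 0) (at_right 0)"
    using filterlim_compose[OF hyp_at_left_1(1)[of "1/4"] fl] by simp
  have lim1: "((\<lambda>t. of_real (1 - r t) * hyp4' (of_real (r t))) \<longlongrightarrow> of_real (sin (pi * (1 / 4)) / pi)) (at_right 0)"
    using filterlim_compose[OF hyp_at_left_1(2)[of "1/4"] fl] by simp
  have C: "sin (pi * (1 / 4)) / pi = 1 / (pi * sqrt 2)"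
    by (simp add: sin_45 real_div_sqrt field_simps)
  have rlim: "(r \<longlongrightarrow> 1) (at_right 0)"
    using \<open>(r \<longlongrightarrow> ((1 - 0) / (1 + 3 * 0)) ^ 2) (at_right 0)\<close> by simp
  have cf: "isCont hyp4 0" by (rule DERIV_isCont[OF hyp4_deriv]) simp
  have cf': "isCont hyp4' 0"
    using hyp'_ode[of "1/4" "3/4" 0] by (auto intro: DERIV_isCont)
  have t0: "((\<lambda>t. complex_of_real t) \<longlongrightarrow> 0) (at_right 0)"
    using tendsto_of_real[OF tendsto_ident_at, of 0] by simp
  have t2: "((\<lambda>t. complex_of_real t ^ 2) \<longlongrightarrow> 0) (at_right 0)"
    using tendsto_power[OF t0, of 2] by simp
  have l1: "((\<lambda>t. hyp4 (of_real t ^ 2)) \<longlongrightarrow> hyp4 0) (at_right 0)"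
    by (rule isCont_tendsto_compose[OF cf t2])
  have l2: "((\<lambda>t. hyp4' (of_real t ^ 2)) \<longlongrightarrow> hyp4' 0) (at_right 0)"
    by (rule isCont_tendsto_compose[OF cf' t2])
  have "isCont csqrt 1" by (rule DERIV_isCont[OF has_field_derivative_csqrt]) simp
  moreover have "((\<lambda>t. 1 + 3 * complex_of_real t) \<longlongrightarrow> 1 + 3 * 0) (at_right 0)"
    by (intro tendsto_intros t0)
  ultimately have ls: "((\<lambda>t. csqrt (1 + 3 * of_real t)) \<longlongrightarrow> 1) (at_right 0)"
    using isCont_tendsto_compose[of 1 csqrt] by fastforce
  \<comment> \<open>Since 1 - r = 8 t (1 + t) / (1 + 3t)^2, the factor t (1 - t^2) equals q (1 - r)
    with q bounded near 0; this supplies the factor 1 - r required by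
    \<open>hyp_at_left_1\<close>.\<close>
  define q where "q t = complex_of_real ((1 - t) * (1 + 3 * t) ^ 2 / 8)" for t :: real
  have lq: "(q \<longlongrightarrow> of_real ((1 - 0) * (1 + 3 * 0) ^ 2 / 8)) (at_right 0)"
    unfolding q_def[abs_def] by (intro tendsto_intros) auto
  have "((\<lambda>t. hyp4 (of_real t ^ 2) *
            (- (3 / 2) * (q t / csqrt (1 + 3 * of_real t) ^ 3) * (of_real (1 - r t) * hyp4 (of_real (r t)))
             - csqrt (1 + 3 * of_real t) * (of_real (r t) * (of_real (1 - r t) * hyp4' (of_real (r t)))))
          - 2 * of_real t * hyp4' (of_real t ^ 2) * (q t * (of_real (1 - r t) * hyp4 (of_real (r t))) / csqrt (1 + 3 * of_real t)))
       \<longlongrightarrow> hyp4 0 * (- (3 / 2) * (of_real ((1 - 0) * (1 + 3 * 0) ^ 2 / 8) / 1 ^ 3) * 0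
             - 1 * (of_real 1 * of_real (sin (pi * (1 / 4)) / pi)))
          - 2 * 0 * hyp4' 0 * (of_real ((1 - 0) * (1 + 3 * 0) ^ 2 / 8) * 0 / 1)) (at_right 0)"
    by (intro tendsto_intros l1 l2 ls lq lim0 lim1 t0 rlim) auto
  hence lim: "((\<lambda>t. hyp4 (of_real t ^ 2) *
            (- (3 / 2) * (q t / csqrt (1 + 3 * of_real t) ^ 3) * (of_real (1 - r t) * hyp4 (of_real (r t)))
             - csqrt (1 + 3 * of_real t) * (of_real (r t) * (of_real (1 - r t) * hyp4' (of_real (r t)))))
          - 2 * of_real t * hyp4' (of_real t ^ 2) * (q t * (of_real (1 - r t) * hyp4 (of_real (r t))) / csqrt (1 + 3 * of_real t)))
       \<longlongrightarrow> - of_real (1 / (pi * sqrt 2))) (at_right 0)"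
    unfolding C by simp
  show ?thesis
  proof (rule Lim_transform_eventually[OF lim])
    show "\<forall>\<^sub>F t in at_right 0. hyp4 (of_real t ^ 2) *
            (- (3 / 2) * (q t / csqrt (1 + 3 * of_real t) ^ 3) * (of_real (1 - r t) * hyp4 (of_real (r t)))
             - csqrt (1 + 3 * of_real t) * (of_real (r t) * (of_real (1 - r t) * hyp4' (of_real (r t)))))
          - 2 * of_real t * hyp4' (of_real t ^ 2) * (q t * (of_real (1 - r t) * hyp4 (of_real (r t))) / csqrt (1 + 3 * of_real t))
        = wronskian_hyp4 (of_real t)"
      using ev
    proof eventually_elim
      case (elim t)
      define w where "w = complex_of_real t"
      have fr: "fricke w ^ 2 = of_real (r t)"
        by (simp add: fricke_def w_def r_def)
      have "(1 - t) * (1 + 3 * t) ^ 2 / 8 * (1 - r t) = t * (1 - t ^ 2)"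
        using elim unfolding r_def by (simp add: divide_simps) (simp add: algebra_simps power_eq_if)
      hence "complex_of_real (t * (1 - t ^ 2)) = q t * of_real (1 - r t)"
        unfolding q_def by (metis of_real_mult)
      moreover have "w * (1 - w ^ 2) = of_real (t * (1 - t ^ 2))" by (simp add: w_def)
      ultimately have P: "w * (1 - w ^ 2) = q t * of_real (1 - r t)" by simp
      have Re: "Re (1 + 3 * w) > 0" using elim by (simp add: w_def)
      have d: "1 - complex_of_real (r t) = of_real (1 - r t)" by simp
      have gen: "A * (- (3 / 2) * (q / c ^ 3) * (d * F) - c * (R * (d * G))) - 2 * w * B * (q * (d * F) / c)
          = A * (- (3 / 2) * (q * d / c ^ 3) * F - c * (R * d * G)) - q * d * (2 * w * B) * (F / c)"
        for A q c d F R G w B :: complex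
        by (simp add: mult_ac)
      show ?case
        unfolding wronskian_hyp4_def w_def[symmetric] twist'_altdef[OF Re] twist_def
        unfolding fr d P by (rule gen)
    qed
  qed
qed

lemma wronskian_hyp4_eq:
  assumes w: "Re w \<ge> 0" "Im w \<ge> 0" "w \<noteq> 0" "norm w < 1"
  shows "wronskian_hyp4 w = - of_real (1 / (pi * sqrt 2))"
proof -
  \<comment> \<open>The condition Re w + Im w > 0 removes 0 from the quarter disc without destroying
    convexity, while the real points near 0, where the limit is taken, remain in T.\<close>
  define T where "T = {w. 0 \<le> Re w} \<inter> {w. 0 \<le> Im w} \<inter> {w. 0 < Re w + Im w} \<inter> ball 0 1"
  have "convex T"
    unfolding T_def
  proof (intro convex_Int convex_ball)
    show "convex {w. 0 \<le> Re w}" "convex {w. 0 \<le> Im w}"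
      by (simp_all add: convex_halfspace_Re_ge convex_halfspace_Im_ge)
    have "{w. 0 < Re w + Im w} = {w. inner (Complex 1 1) w > 0}"
      by (simp add: inner_complex_def)
    thus "convex {w. 0 < Re w + Im w}" by (simp add: convex_halfspace_gt)
  qed
  have der: "(wronskian_hyp4 has_field_derivative 0) (at w within T)" if "w \<in> T" for w
  proof (rule has_field_derivative_at_within)
    have w: "Re w \<ge> 0" "w \<noteq> 0" "norm w < 1" "Re (1 + 3 * w) > 0"
      using that by (auto simp: T_def)
    have fr: "norm (fricke w ^ 2) < 1"
      using norm_fricke_less_1[OF w(1,2)] by (simp add: norm_power power_less_one_iff)
    show "(wronskian_hyp4 has_field_derivative 0) (at w)"
      unfolding wronskian_hyp4_def[abs_def]
      by (rule DERIV_cong[OF DERIV_diff[OF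
            DERIV_mult[OF hyp4_square_deriv(1)[OF w(3)] twist_self_adjoint[where h = hyp4 and h' = hyp4', OF w(4) hyp4_deriv[OF fr] hyp4_self_adjoint[OF fr]]]
            DERIV_mult[OF hyp4_square_deriv(2)[OF w(3)] has_field_derivative_twist[where h = hyp4 and h' = hyp4', OF w(4) hyp4_deriv[OF fr]]]]])
         (simp add: algebra_simps)
  qed
  then obtain c where c: "\<And>w. w \<in> T \<Longrightarrow> wronskian_hyp4 w = c"
    using has_field_derivative_zero_constant[OF \<open>convex T\<close>] by blast
  have "eventually (\<lambda>t::real. t \<in> {0<..<1}) (at_right 0)"
    by (rule eventually_at_right_real) simp
  hence "eventually (\<lambda>t. wronskian_hyp4 (of_real t) = c) (at_right 0)"
    by eventually_elim (rule c, simp add: T_def)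
  hence "((\<lambda>t. wronskian_hyp4 (of_real t)) \<longlongrightarrow> c) (at_right 0)"
    by (rule tendsto_eventually)
  hence "c = - of_real (1 / (pi * sqrt 2))"
    using wronskian_hyp4_tendsto by (rule tendsto_unique[OF trivial_limit_at_right_real])
  moreover have "w \<in> T"
  proof -
    have "Re w + Im w > 0" using w by (auto simp: complex_eq_iff)
    thus ?thesis using w by (simp add: T_def)
  qed
  ultimately show ?thesis using c by simp
qed

section \<open>The quadratic transformation along a segment\<close>

text \<open>Since \<open>fricke 0 = 1\<close>, the twisted function is regular at 0 with value 1,
  and it solves the same equation as \<open>hyp4 (w ^ 2)\<close>. The uniqueness lemma on the
  segment also gives equality of the derivatives.\<close>

lemma twist_hyp4_one_minus:
  assumes w: "w \<in> closed_segment 0 (\<i> / (3 * sqrt 7))" "w \<noteq> 0"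
  shows "twist (\<lambda>y. hyp4 (1 - y)) w = hyp4 (w ^ 2)"
    and "twist' (\<lambda>y. hyp4 (1 - y)) (\<lambda>y. - hyp4' (1 - y)) w = 2 * w * hyp4' (w ^ 2)"
proof -
  define S where "S = closed_segment 0 (\<i> / complex_of_real (3 * sqrt 7))"
  have S: "norm x < 1" "norm (x ^ 2) < 1 / 2" "Re (1 + 3 * x) > 0" "norm (1 - fricke x ^ 2) < 1" "x ^ 2 \<noteq> 1"
    if x: "x \<in> S" for x
  proof -
    from x obtain u where u: "0 \<le> u" "u \<le> 1" and xu: "x = u *\<^sub>R (\<i> / complex_of_real (3 * sqrt 7))"
      unfolding S_def in_segment by auto
    define v where "v = u / (3 * sqrt 7)"
    have xv: "x = \<i> * of_real v" by (simp add: xu v_def scaleR_conv_of_real)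
    have v2: "v ^ 2 = u ^ 2 / 63" by (simp add: v_def power_divide power_mult_distrib)
    have "u ^ 2 \<le> 1" using u by (simp add: power_le_one)
    hence q: "0 \<le> v ^ 2" "v ^ 2 \<le> 1 / 63" unfolding v2 by auto
    have nx2: "norm x ^ 2 = v ^ 2" by (simp add: xv norm_mult)
    thus n2: "norm (x ^ 2) < 1 / 2" using q by (simp add: norm_power)
    have "norm x ^ 2 < 1 ^ 2" using q nx2 by simp
    thus n1: "norm x < 1" by (rule power_less_imp_less_base) simp
    show "Re (1 + 3 * x) > 0" by (simp add: xv)
    show "x ^ 2 \<noteq> 1" using n2 by auto
    have ne: "1 + 3 * x \<noteq> 0" by (simp add: xv complex_eq_iff)
    have "1 - fricke x ^ 2 = 8 * x * (1 + x) / (1 + 3 * x) ^ 2"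
      using ne unfolding fricke_def by (simp add: divide_simps) (simp add: algebra_simps power_eq_if)
    \<comment> \<open>With q = v^2 at most 1/63 the claim is 64 q (1 + q) < (1 + 9q)^2, that is 46 q
      < 1 + 17 q^2.\<close>
    moreover have "norm (8 * x * (1 + x)) < norm ((1 + 3 * x) ^ 2)"
    proof (rule power_less_imp_less_base)
      have a: "norm (1 + x) ^ 2 = 1 + v ^ 2" "norm (1 + 3 * x) ^ 2 = 1 + 9 * v ^ 2"
        unfolding cmod_power2 by (simp_all add: xv power2_eq_square)
      have "norm (8 * x * (1 + x)) ^ 2 = 64 * v ^ 2 * (1 + v ^ 2)"
        by (simp add: norm_mult power_mult_distrib nx2 a)
      also have "\<dots> < (1 + 9 * v ^ 2) ^ 2"
        using q zero_le_power[of "v ^ 2" 2] by (simp add: power2_eq_square algebra_simps)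
      also have "\<dots> = norm ((1 + 3 * x) ^ 2) ^ 2"
        unfolding norm_power a ..
      finally show "norm (8 * x * (1 + x)) ^ 2 < norm ((1 + 3 * x) ^ 2) ^ 2" .
    qed simp
    ultimately show "norm (1 - fricke x ^ 2) < 1"
      using ne by (simp add: norm_divide)
  qed
  have h: "((\<lambda>y. hyp4 (1 - y)) has_field_derivative - hyp4' (1 - y)) (at y)" if "norm (1 - y) < 1" for y
    by (rule DERIV_cong[OF DERIV_chain2[where g = "\<lambda>y. 1 - y", OF hyp4_deriv[OF that]]]) (auto intro!: derivative_eq_intros)
  \<comment> \<open>The weight y (1 - y) is invariant under y -> 1 - y, so reflected solutions
    satisfy the same equation.\<close>
  have p: "((\<lambda>y. y * (1 - y) * - hyp4' (1 - y)) has_field_derivative 3 / 16 * hyp4 (1 - y)) (at y)" if "norm (1 - y) < 1" for y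
  proof -
    have "((\<lambda>y. - ((1 - y) * (1 - (1 - y)) * hyp4' (1 - y))) has_field_derivative - (3 / 16 * hyp4 (1 - y) * - 1)) (at y)"
      by (intro DERIV_minus DERIV_chain2[where g = "\<lambda>y. 1 - y" and f = "\<lambda>z. z * (1 - z) * hyp4' z", OF hyp4_self_adjoint[OF that]]) (auto intro!: derivative_eq_intros)
    thus ?thesis by (simp add: mult_ac)
  qed
  have w': "w \<in> S" using w by (simp add: S_def)
  note sl = sturm_liouville_unique[where S = S and z = w and u = "\<lambda>w. hyp4 (w ^ 2)" and u' = "\<lambda>w. 2 * w * hyp4' (w ^ 2)" and
      v = "twist (\<lambda>y. hyp4 (1 - y))" and v' = "twist' (\<lambda>y. hyp4 (1 - y)) (\<lambda>y. - hyp4' (1 - y))" and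
      P = "\<lambda>w. w * (1 - w ^ 2)" and Q = "\<lambda>w. 3 / 4 * w", OF _ _ _ _
       has_field_derivative_at_within[OF hyp4_square_deriv(1)] has_field_derivative_at_within[OF has_field_derivative_twist]
       has_field_derivative_at_within[OF hyp4_square_deriv(2)] has_field_derivative_at_within[OF twist_self_adjoint]]
  have S0: "convex S" "0 \<in> S" by (simp_all add: S_def)
  have i: "twist (\<lambda>y. hyp4 (1 - y)) 0 = hyp4 (0 ^ 2)" by (simp add: twist_def fricke_def)
  have nz: "hyp4 (x ^ 2) \<noteq> 0" if "x \<in> S" for x
    by (rule hyp_nonzero) (use S[OF that] in auto)
  show "twist (\<lambda>y. hyp4 (1 - y)) w = hyp4 (w ^ 2)"
    by (rule sl(1)) (use S h p S0 i nz w' in auto)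
  show "twist' (\<lambda>y. hyp4 (1 - y)) (\<lambda>y. - hyp4' (1 - y)) w = 2 * w * hyp4' (w ^ 2)"
    by (rule sl(2)) (use S h p S0 i nz w' w in auto)
qed

section \<open>Evaluations at points with complex multiplication\<close>

text \<open>The point 1/3 is fixed by \<open>fricke\<close>, so the Wronskian involves
  \<open>hyp4\<close> and its derivative at 1/9 only. The remaining factor 1 / sqrt 2 occurs on both
  sides and cancels.\<close>

lemma hyp4_at_1_9: "hyp4 (1 / 9) ^ 2 + 16 / 9 * hyp4 (1 / 9) * hyp4' (1 / 9) = of_real (9 / (2 * pi))"
proof -
  define s where "s = csqrt 2"
  have s: "s = of_real (sqrt 2)" by (simp add: s_def)
  have s2: "s ^ 2 = 2" by (simp only: s_def power2_csqrt)
  have s0: "s \<noteq> 0" using s2 by auto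
  have c: "1 + 3 * (1 / 3 :: complex) = 2" "fricke (1 / 3) = 1 / 3" "(1 / 3 :: complex) ^ 2 = 1 / 9"
    by (simp_all add: fricke_def power2_eq_square)
  have s35: "s ^ 3 = 2 * s" "s ^ 5 = 4 * s"
    using s2 by (simp_all add: power_eq_if)
  have "wronskian_hyp4 (1 / 3) = - of_real (1 / (pi * sqrt 2))"
    by (rule wronskian_hyp4_eq) (auto simp: norm_divide)
  moreover have "wronskian_hyp4 (1 / 3) = - (8 / (27 * s) * (3 / 4 * hyp4 (1 / 9) ^ 2 + 4 / 3 * hyp4 (1 / 9) * hyp4' (1 / 9)))"
    unfolding wronskian_hyp4_def twist_def twist'_def c s_def[symmetric] s35 using s0
    by (simp add: field_simps power2_eq_square)
  moreover have "of_real (1 / (pi * sqrt 2)) = 1 / (of_real pi * s)"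
    by (simp add: s)
  ultimately have "8 / 27 * (3 / 4 * hyp4 (1 / 9) ^ 2 + 4 / 3 * hyp4 (1 / 9) * hyp4' (1 / 9)) / s = 1 / of_real pi / s"
    by simp
  hence *: "8 / 27 * (3 / 4 * hyp4 (1 / 9) ^ 2 + 4 / 3 * hyp4 (1 / 9) * hyp4' (1 / 9)) = 1 / of_real pi"
    using s0 by (simp only: divide_cancel_right) simp
  have "hyp4 (1 / 9) ^ 2 + 16 / 9 * hyp4 (1 / 9) * hyp4' (1 / 9) =
      9 / 2 * (8 / 27 * (3 / 4 * hyp4 (1 / 9) ^ 2 + 4 / 3 * hyp4 (1 / 9) * hyp4' (1 / 9)))"
    by simp
  also have "\<dots> = of_real (9 / (2 * pi))"
    unfolding * by simp
  finally show ?thesis .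
qed

text \<open>At w = i / sqrt 3 one has \<open>fricke w = - w\<close>, so both solutions are evaluated
  at w^2 = -1/3.\<close>

lemma hyp4_at_minus_1_3: "hyp4 (- 1 / 3) ^ 2 - 8 / 3 * hyp4 (- 1 / 3) * hyp4' (- 1 / 3) = of_real (sqrt 3 / pi)"
proof -
  define r3 where "r3 = complex_of_real (sqrt 3)"
  define r2 where "r2 = complex_of_real (sqrt 2)"
  have r: "r3 ^ 2 = 3" "r2 ^ 2 = 2" "r3 \<noteq> 0" "r2 \<noteq> 0"
    by (simp_all add: r3_def r2_def flip: of_real_power)
  define w where "w = \<i> / r3"
  have w2: "w ^ 2 = - 1 / 3" using r by (simp add: w_def power_divide)
  hence ww: "w * w = - 1 / 3" "w * (w * x) = - 1 / 3 * x" for x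
    by (simp_all add: power2_eq_square flip: mult.assoc)
  have w0: "w \<noteq> 0" using r by (simp add: w_def)
  have wi: "Re w \<ge> 0" "Im w \<ge> 0" "norm w < 1"
    by (simp_all add: w_def r3_def norm_divide flip: of_real_divide)
  define s where "s = csqrt (1 + 3 * w)"
  have s2: "s ^ 2 = 1 + 3 * w" by (simp add: s_def)
  have "1 + 3 * w \<noteq> 0" using wi(1) by (auto simp: complex_eq_iff)
  hence s0: "s \<noteq> 0" unfolding s_def by simp
  \<comment> \<open>Because w^2 = -1/3, the number 1 + 3w equals (3/2) (1 + w)^2; the sign of the
    root is fixed by its positive real part.\<close>
  have ss: "s = r3 * (1 + w) / r2"
    unfolding s_def
  proof (rule csqrt_unique)
    show "(r3 * (1 + w) / r2) ^ 2 = 1 + 3 * w"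
      using r w2 by (simp add: power_divide power_mult_distrib power2_sum)
    have "r3 * (1 + w) / r2 = (r3 + \<i>) / r2"
      using r by (simp add: w_def field_simps)
    thus "0 < Re (r3 * (1 + w) / r2) \<or> Re (r3 * (1 + w) / r2) = 0 \<and> 0 \<le> Im (r3 * (1 + w) / r2)"
      by (simp add: r2_def r3_def Re_divide_of_real)
  qed
  have fr: "fricke w = - w"
    using \<open>1 + 3 * w \<noteq> 0\<close> w2 by (simp add: fricke_def field_simps power2_eq_square)
  have fr2: "fricke w ^ 2 = - 1 / 3" by (simp add: fr w2)
  define F where "F = hyp4 (- 1 / 3)"
  define F' where "F' = hyp4' (- 1 / 3)"
  have "wronskian_hyp4 w = - of_real (1 / (pi * sqrt 2))"
    by (rule wronskian_hyp4_eq) (use wi w0 in auto)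
  hence "(4 / 3) * w * (F * (- (3 / 2) * F / s ^ 3 + 8 * w * F' / s ^ 5) - 2 * w * F' * (F / s)) = - 1 / (of_real pi * r2)"
    unfolding wronskian_hyp4_def twist_def twist'_def fr2 w2 s_def[symmetric]
    unfolding fr F_def[symmetric] F'_def[symmetric]
    by (simp add: r2_def algebra_simps)
  moreover have "F * (- (3 / 2) * F / s ^ 3 + 8 * w * F' / s ^ 5) - 2 * w * F' * (F / s)
     = (- (3 / 2) * F ^ 2 + (8 * w / s ^ 2 - 2 * w * s ^ 2) * F * F') / s ^ 3"
    using s0 by (simp add: divide_simps) (simp add: algebra_simps power_eq_if)
  \<comment> \<open>From (1 + 3w) (1 - 3w) = 1 - 9 w^2 = 4, the two terms combine to -12 w^2 = 4, so
    the coefficient of F F' is real.\<close>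
  moreover have "8 * w / s ^ 2 - 2 * w * s ^ 2 = 4"
  proof -
    have "8 * w / (1 + 3 * w) = 2 * w * (1 - 3 * w)"
      unfolding nonzero_divide_eq_eq[OF \<open>1 + 3 * w \<noteq> 0\<close>] by (simp add: algebra_simps ww)
    thus ?thesis unfolding s2 by (simp add: algebra_simps power2_eq_square ww)
  qed
  ultimately have "(4 / 3) * w * ((- (3 / 2) * F ^ 2 + 4 * F * F') / s ^ 3) = - 1 / (of_real pi * r2)"
    by (simp only:)
  moreover have "- (3 / 2) * F ^ 2 + 4 * F * F' = - (3 / 2) * (F ^ 2 - 8 / 3 * F * F')"
    by (simp add: field_simps)
  moreover have "Z = s ^ 3 / (2 * w * of_real pi * r2)"
    if "(4 / 3) * w * ((- (3 / 2) * Z) / s ^ 3) = - 1 / (of_real pi * r2)" for Z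
    using that s0 w0 r by (simp add: field_simps)
  ultimately have "F ^ 2 - 8 / 3 * F * F' = s ^ 3 / (2 * w * of_real pi * r2)"
    by (simp only:)
  also have "s ^ 3 = s * s ^ 2" by (simp add: power3_eq_cube power2_eq_square)
  also have "\<dots> = r3 / r2 * ((1 + w) * (1 + 3 * w))"
    unfolding s2 by (simp add: ss)
  also have "(1 + w) * (1 + 3 * w) = 4 * w"
    by (simp add: algebra_simps power2_eq_square ww)
  also have "r3 / r2 * (4 * w) / (2 * w * of_real pi * r2) = r3 / of_real pi"
    using w0 r by (simp add: field_simps power2_eq_square)
  finally show ?thesis by (simp add: F_def F'_def r3_def)
qed

text \<open>Here \<open>fricke w1 = - w0\<close> while \<open>fricke w0 = v\<close> and w1^2 = 1 -
  v^2. Thus the Wronskian at w1 involves \<open>hyp4\<close> at w0^2 = -1/63 and at w1^2, and the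
  quadratic transformation at w0 expresses the latter values through the former.\<close>

lemma hyp4_at_minus_1_63: "hyp4 (- 1 / 63) ^ 2 - 16 / 63 * hyp4 (- 1 / 63) * hyp4' (- 1 / 63) = of_real (9 * sqrt 7 / (8 * pi))"
proof -
  define r7 where "r7 = complex_of_real (sqrt 7)"
  define r2 where "r2 = complex_of_real (sqrt 2)"
  have r: "r7 ^ 2 = 7" "r2 ^ 2 = 2" "r7 \<noteq> 0" "r2 \<noteq> 0"
    by (simp_all add: r7_def r2_def flip: of_real_power)
  define j where "j = \<i> / r7"
  have jj: "j * j = - 1 / 7" using r by (simp add: j_def field_simps power2_eq_square)
  \<comment> \<open>Together with \<open>jj\<close> this lets the simplifier reduce polynomials in j
    to linear ones; apart from square roots, all constants lie in the field generated by j.\<close>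
  have jp: "j * (j * x) = - 1 / 7 * x" for x by (simp flip: mult.assoc add: jj)
  have Re_j: "Re j = 0" "Im j = 1 / sqrt 7"
    by (simp_all add: j_def r7_def Re_divide_of_real Im_divide_of_real)
  have j0: "j \<noteq> 0" using jj by auto
  have nz: "1 + c * j \<noteq> 0" if "c \<in> \<real>" for c
    using that Re_j by (auto simp: complex_eq_iff elim!: Reals_cases)
  define s where "s = csqrt (1 + j)"
  have s2: "s ^ 2 = 1 + j" by (simp add: s_def)
  have s0: "s \<noteq> 0" using s2 nz[of 1] by auto
  define w0 where "w0 = 1 / 3 * j"
  define w1 where "w1 = 5 / 6 + 7 / 6 * j"
  define v where "v = 5 / 6 - 7 / 6 * j"
  have sq: "w0 ^ 2 = - 1 / 63" "w1 ^ 2 = 1 - v ^ 2"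
    by (simp_all add: w0_def w1_def v_def power2_eq_square algebra_simps jj jp)
  have frw0: "fricke w0 = v"
  proof -
    have "1 - w0 = v * (1 + j)" by (simp add: w0_def v_def algebra_simps add_divide_distrib diff_divide_distrib jj jp)
    moreover have "1 + 3 * w0 = 1 + j" by (simp add: w0_def)
    ultimately show ?thesis using nz[of 1] by (simp add: fricke_def)
  qed
  have c0: "1 + 3 * w0 = 1 + j" by (simp add: w0_def)
  have c1: "1 + 3 * w1 = 7 / 2 * (1 + j)" by (simp add: w1_def field_simps)
  have frw1: "fricke w1 = - w0"
  proof -
    have "1 - w1 = - w0 * (1 + 3 * w1)" unfolding c1 by (simp add: w0_def w1_def algebra_simps add_divide_distrib diff_divide_distrib jj jp)
    moreover have "1 + 3 * w1 \<noteq> 0" unfolding c1 mult_eq_0_iff using nz[of 1] by simp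
    ultimately show ?thesis by (simp add: fricke_def)
  qed
  \<comment> \<open>As 1 + 3 w1 is 7/2 times 1 + 3 w0, the two square roots differ by the real
    factor k = sqrt(7/2), and a single s serves both points.\<close>
  define k where "k = r7 / r2"
  have k: "k ^ 2 = 7 / 2" "k \<noteq> 0" using r by (simp_all add: k_def power_divide)
  have S: "csqrt (1 + 3 * w1) = k * s"
    unfolding c1
  proof (rule csqrt_unique)
    show "(k * s) ^ 2 = 7 / 2 * (1 + j)" by (simp add: power_mult_distrib k s2)
    have "k * s = of_real (sqrt 7 / sqrt 2) * s" by (simp add: k_def r7_def r2_def)
    hence "Re (k * s) = sqrt 7 / sqrt 2 * Re s" by (simp only: Re_complex_of_real times_complex.sel Im_complex_of_real)
    moreover have "Re s > 0"
    proof -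
      have "Re s \<ge> 0" by (simp add: s_def csqrt.sel Re_j)
      moreover have "Re s \<noteq> 0"
      proof
        assume "Re s = 0"
        hence "Re (s ^ 2) \<le> 0" by (simp add: power2_eq_square)
        thus False unfolding s2 by (simp add: Re_j)
      qed
      ultimately show ?thesis by simp
    qed
    ultimately show "0 < Re (k * s) \<or> Re (k * s) = 0 \<and> 0 \<le> Im (k * s)" by simp
  qed
  define F where "F = hyp4 (- 1 / 63)"
  define F' where "F' = hyp4' (- 1 / 63)"
  define T where "T = hyp4 (w1 ^ 2)"
  define T' where "T' = hyp4' (w1 ^ 2)"
  have seg: "w0 \<in> closed_segment 0 (\<i> / (3 * sqrt 7))"
    by (simp add: w0_def j_def r7_def mult.commute)
  have w00: "w0 \<noteq> 0" using j0 by (simp add: w0_def)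
  have v0: "v \<noteq> 0" by (simp add: v_def Re_j complex_eq_iff)
  have "T / s = F"
    using twist_hyp4_one_minus(1)[OF seg w00] unfolding twist_def frw0 c0 sq s_def[symmetric] F_def T_def .
  hence T: "T = s * F" using s0 by (simp add: field_simps)
  have "- (3 / 2) * T / s ^ 3 - 8 * v * (- T') / s ^ 5 = 2 * w0 * F'"
    using twist_hyp4_one_minus(2)[OF seg w00] unfolding twist'_def frw0 c0 sq s_def[symmetric] F'_def T_def T'_def .
  hence "8 * v * T' / s ^ 5 = 2 * w0 * F' + (3 / 2) * T / s ^ 3"
    by (simp add: field_simps)
  hence "T' = s ^ 5 * (2 * w0 * F' + (3 / 2) * T / s ^ 3) / (8 * v)"
    using s0 v0 by (simp add: field_simps)
  also have "\<dots> = s * (2 * w0 * (s ^ 2) ^ 2 * F' + (3 / 2) * s ^ 2 * F) / (8 * v)"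
    using s0 unfolding T by (simp add: divide_simps) (simp add: power_eq_if algebra_simps)
  finally have T': "T' = s * (2 * w0 * (s ^ 2) ^ 2 * F' + (3 / 2) * s ^ 2 * F) / (8 * v)" .
  have "wronskian_hyp4 w1 = - of_real (1 / (pi * sqrt 2))"
  proof (rule wronskian_hyp4_eq)
    show "Re w1 \<ge> 0" "Im w1 \<ge> 0" "w1 \<noteq> 0" by (auto simp: w1_def Re_j complex_eq_iff)
    have "norm w1 ^ 2 = 8 / 9"
      unfolding cmod_power2 by (simp add: w1_def Re_j power_divide)
    hence "norm w1 ^ 2 < 1 ^ 2" by simp
    thus "norm w1 < 1" by (rule power_less_imp_less_base) simp
  qed
  hence W: "T * (w1 * (1 - w1 ^ 2) * (- (3 / 2) * F / (k * s) ^ 3 + 8 * w0 * F' / (k * s) ^ 5))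
      - w1 * (1 - w1 ^ 2) * (2 * w1 * T') * (F / (k * s)) = - 1 / (of_real pi * r2)"
    unfolding wronskian_hyp4_def twist_def twist'_def S frw1 power2_minus sq(1) F_def[symmetric] F'_def[symmetric]
       T_def[symmetric] T'_def[symmetric]
    by (simp add: r2_def)
  define X where "X = F ^ 2"
  define Y where "Y = F * F'"
  \<comment> \<open>Substituting T and T' leaves s only in even powers, so s^2 = 1 + j brings every
    coefficient except k into the field of j.\<close>
  have "T * (w1 * (1 - w1 ^ 2) * (- (3 / 2) * F / (k * s) ^ 3 + 8 * w0 * F' / (k * s) ^ 5))
      - w1 * (1 - w1 ^ 2) * (2 * w1 * T') * (F / (k * s)) =
      w1 * (1 - w1 ^ 2) / k * (X * (- (3 / 2) / (k ^ 2 * s ^ 2) - 3 / 8 * w1 * s ^ 2 / v)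
         + Y * (8 * w0 / ((k ^ 2) ^ 2 * (s ^ 2) ^ 2) - w1 * w0 * (s ^ 2) ^ 2 / (2 * v)))"
    unfolding T T' X_def Y_def using s0 k(2) v0
    by (simp add: divide_simps) (simp add: algebra_simps power_eq_if)
  also have "\<dots> = w1 * (1 - w1 ^ 2) * (X * (- (3 / 7) / (1 + j) - 3 / 8 * w1 * (1 + j) / v)
         + Y * (32 / 49 * w0 / (1 + j) ^ 2 - w1 * w0 * (1 + j) ^ 2 / (2 * v))) / k"
    unfolding s2 k(1) by (simp add: field_simps)
  also have "w1 * (1 - w1 ^ 2) * (X * (- (3 / 7) / (1 + j) - 3 / 8 * w1 * (1 + j) / v)
         + Y * (32 / 49 * w0 / (1 + j) ^ 2 - w1 * w0 * (1 + j) ^ 2 / (2 * v))) = - (4 / 9) * (X - 16 / 63 * Y)"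
  proof -
    \<comment> \<open>Inverses are found by conjugation: (1 + j) (1 - j) = 8/7, and v times its
      conjugate w1 is 8/9. The imaginary parts then cancel in both coefficients.\<close>
    have i1: "1 / (1 + j) = 7 / 8 * (1 - j)" using nz[of 1] jj by (simp add: field_simps)
    have i2: "1 / v = 3 / 16 * (5 + 7 * j)" 
      unfolding nonzero_divide_eq_eq[OF v0]
      by (simp add: v_def algebra_simps add_divide_distrib diff_divide_distrib jj jp)
    have "w1 * (1 - w1 ^ 2) * (X * (- (3 / 7) * (1 / (1 + j)) - 3 / 8 * w1 * (1 + j) * (1 / v))
         + Y * (32 / 49 * w0 * (1 / (1 + j)) ^ 2 - w1 * w0 * (1 + j) ^ 2 * (1 / v) / 2)) = - (4 / 9) * (X - 16 / 63 * Y)"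
      unfolding i1 i2 w1_def w0_def
      by (simp add: power2_eq_square algebra_simps jj jp add_divide_distrib diff_divide_distrib)
    thus ?thesis by (simp add: power_divide mult.commute[of v 2])
  qed
  finally have "- (4 / 9) * (X - 16 / 63 * Y) / k = - 1 / (of_real pi * r2)"
    using W by simp
  moreover have "Z = 9 / 4 * k / (of_real pi * r2)" if "- (4 / 9) * Z / k = - 1 / (of_real pi * r2)" for Z
    using that k(2) r by (simp add: field_simps)
  ultimately have "X - 16 / 63 * Y = 9 / 4 * k / (of_real pi * r2)"
    by blast
  also have "\<dots> = 9 * r7 / (8 * of_real pi)"
    using r by (simp add: k_def field_simps power2_eq_square)
  finally show ?thesis by (simp add: X_def Y_def F_def F'_def r7_def mult.assoc)
qed

section \<open>Assembly of the three series\<close>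

theorem theorem1p4:
  shows "(\<lambda>n::nat. real n / 4 ^ n *
           (\<Sum>k=0..n. ((- 1 / 4 :: real) gchoose k)^2 * ((- 3 / 4 :: real) gchoose (n - k))^2))
         sums (4 * sqrt 3 / (9 * pi))
       \<and> (\<lambda>n::nat. (9 * real n + 2) / (- 8) ^ n *
           (\<Sum>k=0..n. ((- 1 / 4 :: real) gchoose k)^2 * ((- 3 / 4 :: real) gchoose (n - k))^2))
         sums (4 / pi)
       \<and> (\<lambda>n::nat. (9 * real n + 1) / 64 ^ n *
           (\<Sum>k=0..n. ((- 1 / 4 :: real) gchoose k)^2 * ((- 3 / 4 :: real) gchoose (n - k))^2))
         sums (64 / (7 * sqrt 7 * pi))"
proof -
  define c where "c n = (\<Sum>k=0..n. ((- 1 / 4 :: real) gchoose k)^2 * ((- 3 / 4 :: real) gchoose (n - k))^2)" for n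
  \<comment> \<open>With x = 1/m, K is the total coefficient of F^2 and K L that of F F' in
    \<open>product_series_sums\<close>. Each pair of \<open>\<alpha>\<close> and
    \<open>\<beta>\<close> below has exactly the ratio L of the evaluated combination, whose value
    is V.\<close>
  have sums: "(\<lambda>n. (\<alpha> * real n + \<beta>) / m ^ n * c n) sums (K * V)"
    if x: "\<bar>1 / m\<bar> < 1 / 2" and z: "complex_of_real (1 / m / (1 / m - 1)) = z"
      and K: "of_real (\<alpha> * (1 / m)) / of_real (1 - 1 / m) ^ 2 + of_real \<beta> / of_real (1 - 1 / m) = complex_of_real K"
             "of_real (\<alpha> * (1 / m)) * 2 / of_real (1 - 1 / m) ^ 3 = - complex_of_real K * L"
      and V: "hyp4 z ^ 2 + L * hyp4 z * hyp4' z = of_real V"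
    for \<alpha> \<beta> m K V z L
  proof -
    have gen: "p * (F ^ 2 / q ^ 2 - 2 * F * F' / q ^ 3) + b * F ^ 2 / q = (p / q ^ 2 + b / q) * F ^ 2 - (p * 2 / q ^ 3) * F * F'"
      for p q b F F' :: complex
      by (simp add: right_diff_distrib distrib_right)
    have "of_real (\<alpha> * (1 / m)) * (hyp4 z ^ 2 / of_real (1 - 1 / m) ^ 2 - 2 * hyp4 z * hyp4' z / of_real (1 - 1 / m) ^ 3)
                  + of_real \<beta> * hyp4 z ^ 2 / of_real (1 - 1 / m) = of_real K * (hyp4 z ^ 2 + L * hyp4 z * hyp4' z)"
      unfolding gen K by (simp add: algebra_simps)
    also have "\<dots> = of_real (K * V)"
      unfolding V by simp
    finally have "(\<lambda>n. complex_of_real ((\<alpha> * real n + \<beta>) * (1 / m) ^ n * c n)) sums of_real (K * V)"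
      using product_series_sums[of "1 / 4" "1 / m" \<alpha> \<beta>] x unfolding z c_def by simp
    hence "(\<lambda>n. (\<alpha> * real n + \<beta>) * (1 / m) ^ n * c n) sums (K * V)"
      by (simp only: sums_of_real_iff)
    thus ?thesis by (simp add: divide_inverse power_inverse)
  qed
  have "(\<lambda>n. (1 * real n + 0) / 4 ^ n * c n) sums (4 / 9 * (sqrt 3 / pi))"
    by (rule sums[where z = "- 1 / 3" and L = "- 8 / 3"])
       (use hyp4_at_minus_1_3 in \<open>simp_all add: power_divide\<close>)
  moreover have "(\<lambda>n. (9 * real n + 2) / (- 8) ^ n * c n) sums (8 / 9 * (9 / (2 * pi)))"
    by (rule sums[where z = "1 / 9" and L = "16 / 9"])
       (use hyp4_at_1_9 in \<open>simp_all add: power_divide\<close>)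
  moreover have "(\<lambda>n. (9 * real n + 1) / 64 ^ n * c n) sums (512 / 441 * (9 * sqrt 7 / (8 * pi)))"
    by (rule sums[where z = "- 1 / 63" and L = "- 16 / 63"])
       (use hyp4_at_minus_1_63 in \<open>simp_all add: power_divide\<close>)
  moreover have "512 / 441 * (9 * sqrt 7 / (8 * pi)) = 64 / (7 * sqrt 7 * pi)"
    by (simp add: field_simps)
  ultimately show ?thesis unfolding c_def by simp
qed

end
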